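(* Fix $\delta\in(0,1)$ and $\epsilon_{\max}\in(0,1/2)$, and let the variance $\sigma^2>0$ be known. Let $\widetilde\theta$, $M$, $N_0$ be the pilot estimator and constants described in the context, and let $\kappa\ge \max\{\sqrt2, M/\pi\}$ be a constant. Let $\widehat{\mathrm{CI}}$ be the confidence set defined in the context from $n$ i.i.d. observations (with this $\kappa$). Then there exist constants $C>0$ and $N$, depending only on $\delta$, $\epsilon_{\max}$ and $\kappa$, such that for all $n\ge N$, $$\inf_{\theta\in\mathbb R}\ \inf_{\varepsilon\in[0,\epsilon_{\max}],\,Q}\ P^n_{\theta,\sigma,\varepsilon,Q}\Big(\theta\in\widehat{\mathrm{CI}},\ |\widehat{\mathrm{CI}}|\le \overline r(n,\sigma,\varepsilon)\Big)\ \ge\ 1-\delta,$$ where $$\overline r(n,\sigma,\varepsilon)=C\sigma\left(\frac1{n^{1/4}}+\frac{\varepsilon^{1/2}}{\sqrt{1\vee\log(en\varepsilon^2)}}\right).$$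
   Context: Notation. $a\vee b=\max\{a,b\}$; for $\varepsilon=0$ the term $\varepsilon^{1/2}/\sqrt{1\vee\log(en\varepsilon^2)}$ is $0$. For $I\subseteq\mathbb R$, $|I|=\sup I-\inf I$ denotes its diameter (length). $\mathrm i$ is the imaginary unit. Model (Efron's Gaussian two-groups model). For $\theta\in\mathbb R$, $\sigma>0$, $\varepsilon\in[0,1/2)$ and $Q$ an arbitrary probability distribution on $\mathbb R$, $$P_{\theta,\sigma,\varepsilon,Q}=(1-\varepsilon)\,\mathcal N(\theta,\sigma^2)+\varepsilon\, Q*\mathcal N(0,\sigma^2),$$ and $P^n_{\theta,\sigma,\varepsilon,Q}$ is the law of i.i.d. $X_1,\dots,X_n\sim P_{\theta,\sigma,\varepsilon,Q}$. Infima over $Q$ range over all probability distributions on $\mathbb R$. Pilot estimator. $\widetilde\theta=\widetilde\theta(X_1,\dots,X_n)$ is a fixed estimator and $M,N_0$ are constants depending only on $\delta$ and $\epsilon_{\max}$ such that for all $n\ge N_0$, $$\inf_{\theta\in\mathbb R,\,\sigma^2>0,\,Q}P^n_{\theta,\sigma,\epsilon_{\max},Q}\Big(|\widetilde\theta-\theta|\le \frac{M\sigma}{\sqrt{\log(en)}}\Big)\ge 1-\frac\delta2$$ (such an estimator and constants exist). Since every $P_{\theta,\sigma,\varepsilon,Q}$ with $\varepsilon\le\epsilon_{\max}$ equals some $P_{\theta,\sigma,\epsilon_{\max},Q'}$, the same bound holds for every $\varepsilon\le \epsilon_{\max}$. Confidence set. Let $\phi_n(t)=\frac1n\sum_{j=1}^n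 e^{\mathrm i tX_j}$ be the empirical characteristic function, and set $$\widetilde{\mathrm{CI}}=\Big[\widetilde\theta-\tfrac{M\sigma}{\sqrt{\log(en)}},\ \widetilde\theta+\tfrac{M\sigma}{\sqrt{\log(en)}}\Big],\qquad \Delta(t)=2\kappa e^{\sigma^2t^2}\sqrt{8\log(10/\delta)/n},$$ $$\mathcal T=\big\{\sqrt k\,(\kappa\sigma)^{-1}:\ k=1,2,\dots,\lceil\log(en)\rceil\big\},\qquad \Upsilon_n(t;\mu)=2e^{-\mathrm i\mu t+\sigma^2t^2/2}\phi_n(t)-1.$$ Then $$\widehat{\mathrm{CI}}=\big\{\mu\in\widetilde{\mathrm{CI}}:\ |\Upsilon_n(t;\mu)|\le 1+\Delta(t)\ \text{ for all } t\in\mathcal T\big\}.$$ *)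

theory Defs
  imports "HOL-Probability.Probability"
begin

definition prob_dists :: "real measure set" where
  "prob_dists = {Q. prob_space Q \<and> sets Q = sets borel}"

abbreviation gauss :: "real \<Rightarrow> real \<Rightarrow> real measure" where
  "gauss \<theta> \<sigma> \<equiv> density lborel (\<lambda>x. ennreal (normal_density \<theta> \<sigma> x))"

text \<open>
  The second parameter of \<^const>\<open>normal_density\<close> is the standard deviation, so
  \<open>gauss \<theta> \<sigma>\<close> is the normal law with mean \<open>\<theta>\<close> and variance \<open>\<sigma>\<^sup>2\<close>.
\<close>

definition two_groups :: "real \<Rightarrow> real \<Rightarrow> real \<Rightarrow> real measure \<Rightarrow> real measure" where
  "two_groups \<theta> \<sigma> \<epsilon> Q = measure_of UNIV (sets borel)
     (\<lambda>A. ennreal (1 - \<epsilon>) * emeasure (gauss \<theta> \<sigma>) A + ennreal \<epsilon> * emeasure (Q \<star> gauss 0 \<sigma>) A)"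

text \<open>A sample of size \<open>n\<close> is a function on \<open>{1..n}\<close>.\<close>

definition sample_law :: "nat \<Rightarrow> real \<Rightarrow> real \<Rightarrow> real \<Rightarrow> real measure \<Rightarrow> (nat \<Rightarrow> real) measure" where
  "sample_law n \<theta> \<sigma> \<epsilon> Q = (\<Pi>\<^sub>M j\<in>{1..n}. two_groups \<theta> \<sigma> \<epsilon> Q)"

definition log_en :: "nat \<Rightarrow> real" where
  "log_en n = ln (exp 1 * real n)"

type_synonym estimator = "nat \<Rightarrow> (nat \<Rightarrow> real) \<Rightarrow> real"

text \<open>
  An estimator does not see \<open>\<theta>\<close>, \<open>\<sigma>\<close>, \<open>\<epsilon>\<close> or \<open>Q\<close>: it is one measurable function of the data for each
  sample size. The bound is only required for nonempty samples: at \<open>n = 0\<close> the totalised \<^const>\<open>ln\<close>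
  and division would turn it into an unsatisfiable condition.
\<close>

definition pilot_estimator ::
    "real \<Rightarrow> real \<Rightarrow> real \<Rightarrow> nat \<Rightarrow> estimator \<Rightarrow> bool" where
  "pilot_estimator \<delta> \<epsilon>max M N0 \<tau> \<longleftrightarrow>
     (\<forall>n. \<tau> n \<in> borel_measurable (\<Pi>\<^sub>M j\<in>{1..n}. borel)) \<and>
     (\<forall>n\<ge>1. n \<ge> N0 \<longrightarrow>
        (INF (\<theta>, \<sigma>, Q) \<in> UNIV \<times> {0<..} \<times> prob_dists.
           measure (sample_law n \<theta> \<sigma> \<epsilon>max Q)
             {X \<in> space (sample_law n \<theta> \<sigma> \<epsilon>max Q).
                \<bar>\<tau> n X - \<theta>\<bar> \<le> M * \<sigma> / sqrt (log_en n)})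
        \<ge> 1 - \<delta> / 2)"

definition pilot_CI :: "real \<Rightarrow> real \<Rightarrow> estimator \<Rightarrow> nat \<Rightarrow> (nat \<Rightarrow> real) \<Rightarrow> real set" where
  "pilot_CI M \<sigma> \<tau> n X =
     {\<tau> n X - M * \<sigma> / sqrt (log_en n) .. \<tau> n X + M * \<sigma> / sqrt (log_en n)}"

definition emp_char :: "nat \<Rightarrow> (nat \<Rightarrow> real) \<Rightarrow> real \<Rightarrow> complex" where
  "emp_char n X t = (1 / of_nat n) * (\<Sum>j=1..n. iexp (t * X j))"

definition slack :: "real \<Rightarrow> real \<Rightarrow> real \<Rightarrow> nat \<Rightarrow> real \<Rightarrow> real" where
  "slack \<delta> \<kappa> \<sigma> n t = 2 * \<kappa> * exp (\<sigma>\<^sup>2 * t\<^sup>2) * sqrt (8 * ln (10 / \<delta>) / real n)"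

definition freqs :: "real \<Rightarrow> real \<Rightarrow> nat \<Rightarrow> real set" where
  "freqs \<kappa> \<sigma> n = {sqrt (real k) * inverse (\<kappa> * \<sigma>) |k. 1 \<le> k \<and> k \<le> nat \<lceil>log_en n\<rceil>}"

definition Upsilon :: "real \<Rightarrow> nat \<Rightarrow> (nat \<Rightarrow> real) \<Rightarrow> real \<Rightarrow> real \<Rightarrow> complex" where
  "Upsilon \<sigma> n X t \<mu> =
     2 * exp (- \<i> * of_real \<mu> * of_real t + of_real (\<sigma>\<^sup>2 * t\<^sup>2 / 2)) * emp_char n X t - 1"

definition conf_set ::
    "real \<Rightarrow> real \<Rightarrow> real \<Rightarrow> real \<Rightarrow> estimator \<Rightarrow> nat \<Rightarrow> (nat \<Rightarrow> real) \<Rightarrow> real set" where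
  "conf_set \<delta> M \<kappa> \<sigma> \<tau> n X =
     {\<mu> \<in> pilot_CI M \<sigma> \<tau> n X. \<forall>t\<in>freqs \<kappa> \<sigma> n. cmod (Upsilon \<sigma> n X t \<mu>) \<le> 1 + slack \<delta> \<kappa> \<sigma> n t}"

text \<open>Only meaningful for bounded nonempty sets.\<close>

definition set_length :: "real set \<Rightarrow> real" where
  "set_length I = Sup I - Inf I"

text \<open>At \<open>\<epsilon> = 0\<close> the second summand is \<open>0\<close>, because its numerator is and its denominator is at least \<open>1\<close>.\<close>

definition length_bound :: "real \<Rightarrow> nat \<Rightarrow> real \<Rightarrow> real \<Rightarrow> real" where
  "length_bound C n \<sigma> \<epsilon> =
     C * \<sigma> * (1 / real n powr (1 / 4) + sqrt \<epsilon> / sqrt (max 1 (ln (exp 1 * real n * \<epsilon>\<^sup>2))))"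

lemma space_two_groups [simp]: "space (two_groups \<theta> \<sigma> \<epsilon> Q) = UNIV"
  and sets_two_groups [simp, measurable_cong]: "sets (two_groups \<theta> \<sigma> \<epsilon> Q) = sets borel"
proof -
  have "sigma_algebra UNIV (sets (borel :: real measure))"
    using sets.sigma_algebra_axioms[of "borel :: real measure"] by simp
  then show "space (two_groups \<theta> \<sigma> \<epsilon> Q) = UNIV" "sets (two_groups \<theta> \<sigma> \<epsilon> Q) = sets borel"
    unfolding two_groups_def
    by (auto simp: space_measure_of_conv sets_measure_of_conv sigma_algebra.sigma_sets_eq)
qed

text \<open>The set function in the definition of \<^const>\<open>two_groups\<close> is a measure, so it is not replaced by the zero measure.\<close>

lemma emeasure_two_groups:
  assumes A: "A \<in> sets borel"
  shows "emeasure (two_groups \<theta> \<sigma> \<epsilon> Q) A =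
    ennreal (1 - \<epsilon>) * emeasure (gauss \<theta> \<sigma>) A + ennreal \<epsilon> * emeasure (Q \<star> gauss 0 \<sigma>) A"
proof (rule emeasure_measure_of[OF two_groups_def])
  show "A \<in> sets (two_groups \<theta> \<sigma> \<epsilon> Q)" using A by simp
  show "countably_additive (sets (two_groups \<theta> \<sigma> \<epsilon> Q))
     (\<lambda>A. ennreal (1 - \<epsilon>) * emeasure (gauss \<theta> \<sigma>) A + ennreal \<epsilon> * emeasure (Q \<star> gauss 0 \<sigma>) A)"
  proof (rule countably_additiveI)
    fix F :: "nat \<Rightarrow> real set"
    assume F: "range F \<subseteq> sets (two_groups \<theta> \<sigma> \<epsilon> Q)" "disjoint_family F"
    have 1: "(\<Sum>i. emeasure (gauss \<theta> \<sigma>) (F i)) = emeasure (gauss \<theta> \<sigma>) (\<Union>i. F i)"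
      using F by (intro suminf_emeasure) auto
    have 2: "(\<Sum>i. emeasure (Q \<star> gauss 0 \<sigma>) (F i)) = emeasure (Q \<star> gauss 0 \<sigma>) (\<Union>i. F i)"
      using F by (intro suminf_emeasure) auto
    show "(\<Sum>i. ennreal (1 - \<epsilon>) * emeasure (gauss \<theta> \<sigma>) (F i) + ennreal \<epsilon> * emeasure (Q \<star> gauss 0 \<sigma>) (F i)) =
      ennreal (1 - \<epsilon>) * emeasure (gauss \<theta> \<sigma>) (\<Union>i. F i) + ennreal \<epsilon> * emeasure (Q \<star> gauss 0 \<sigma>) (\<Union>i. F i)"
      by (simp add: suminf_add[symmetric] 1 2)
  qed
qed (auto simp: positive_def)

lemma prob_space_two_groups:
  assumes "\<sigma> > 0" "0 \<le> \<epsilon>" "\<epsilon> \<le> 1" "Q \<in> prob_dists"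
  shows "prob_space (two_groups \<theta> \<sigma> \<epsilon> Q)"
proof (rule prob_spaceI)
  interpret G: prob_space "gauss \<theta> \<sigma>" using assms by (intro prob_space_normal_density)
  interpret G0: prob_space "gauss 0 \<sigma>" using assms by (intro prob_space_normal_density)
  interpret Q: prob_space Q using assms by (simp add: prob_dists_def)
  interpret P: pair_prob_space Q "gauss 0 \<sigma>" ..
  have [measurable_cong]: "sets Q = sets borel" using assms by (simp add: prob_dists_def)
  interpret C: prob_space "Q \<star> gauss 0 \<sigma>"
    unfolding convolution_def by (rule P.prob_space_distr) measurable
  have "emeasure (gauss \<theta> \<sigma>) UNIV = 1" "emeasure (Q \<star> gauss 0 \<sigma>) UNIV = 1"
    using G.emeasure_space_1 C.emeasure_space_1 by simp_all
  then show "emeasure (two_groups \<theta> \<sigma> \<epsilon> Q) (space (two_groups \<theta> \<sigma> \<epsilon> Q)) = 1"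
    using assms by (simp add: emeasure_two_groups flip: ennreal_plus)
qed

end

theory Submission
  imports Defs
begin

text \<open>
  Multiplying the characteristic function of the data at \<open>t\<close> by \<open>e\<^sup>-\<^sup>i\<^sup>\<mu>\<^sup>t\<close> and dividing by that of the
  centred Gaussian noise gives \<open>e\<^sup>-\<^sup>i\<^sup>x z\<close>, where \<open>x = (\<mu> - \<theta>) t\<close> and \<open>z\<close> lies in the disc of radius
  \<open>\<epsilon>\<close> around \<open>1 - \<epsilon>\<close>, whatever \<open>Q\<close> is (\<open>recentred_char_two_groups\<close>). The confidence set accepts
  \<open>\<mu>\<close> if the empirical version \<open>y\<close> of this number satisfies \<open>\<bar>2 y - 1\<bar> \<le> 1\<close> up to the slack. For \<open>\<mu> = \<theta>\<close> this
  holds as soon as the empirical characteristic function is accurate (\<open>coverage\<close>).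

  Conversely, the disc touches the unit circle only at \<open>1\<close>, and a rotation that keeps \<open>z\<close> nearly
  admissible satisfies \<open>1 - cos x = O(\<epsilon> + slack)\<close> (\<open>rotation_bound\<close>, \<open>misfit_small\<close>). The cosine
  determines \<open>\<bar>x\<bar>\<close> only up to half a turn, which is where the pilot interval and \<open>\<kappa> \<ge> M / \<pi>\<close> enter: at
  frequencies with \<open>4 k \<le> log (e n)\<close> two points of the pilot interval differ by an angle of at most
  \<open>\<pi>\<close>. Then \<open>(\<mu> - \<theta>)\<^sup>2 = O((\<epsilon> + slack) / t\<^sup>2)\<close>, and the frequency with
  \<open>t\<^sup>2\<close> of order \<open>l = max 1 (log (e n \<epsilon>\<^sup>2))\<close> keeps the slack of order \<open>\<epsilon> + 1 / \<surd>n\<close> and yields the rate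
  \<open>n\<^sup>-\<^sup>1\<^sup>/\<^sup>4 + \<surd>(\<epsilon> / l)\<close> (\<open>frequency_choice\<close>, \<open>distance_bound\<close>).

  Probabilistically only two things can go wrong, each with probability at most \<open>\<delta> / 2\<close>: the pilot
  estimator (\<open>pilot_bound\<close>) and the accuracy of the empirical characteristic function at one of the
  frequencies (\<open>prob_not_char_accurate\<close>). Since the length of the confidence set is an uncountable
  supremum, the event in question must also be shown to be measurable
  (\<open>conf_set_event_measurable\<close>).
\<close>

section \<open>The model as a smoothed distribution of means\<close>

text \<open>
  A draw from the mixture is made by tossing a \<open>p\<close>-coin and then either sampling \<open>Q\<close> or taking the atom
  \<open>a\<close>. As an image of a product law it is a probability measure by construction, and its integrals
  come from Fubini.
\<close>

definition mix_point :: "real \<Rightarrow> real \<Rightarrow> real measure \<Rightarrow> real measure" where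
  "mix_point p a Q =
     distr (measure_pmf (bernoulli_pmf p) \<Otimes>\<^sub>M Q) borel (\<lambda>(b, x). if b then x else a)"

context
  fixes Q :: "real measure"
  assumes Q: "Q \<in> prob_dists"
begin

lemma sets_prob_dists: "sets Q = sets borel"
  using Q by (simp add: prob_dists_def)

lemma prob_dists_prob_space: "prob_space Q"
  using Q by (simp add: prob_dists_def)

lemma mix_point_measurable:
  "(\<lambda>(b, x). if b then x else a) \<in> measure_pmf (bernoulli_pmf p) \<Otimes>\<^sub>M Q \<rightarrow>\<^sub>M borel"
proof -
  note [simp, measurable_cong] = sets_prob_dists
  have [measurable]: "Measurable.pred (measure_pmf (bernoulli_pmf p) \<Otimes>\<^sub>M Q) fst"
    by (rule measurable_compose[OF measurable_fst]) simp
  have "(\<lambda>z. if fst z then snd z else a) \<in> measure_pmf (bernoulli_pmf p) \<Otimes>\<^sub>M Q \<rightarrow>\<^sub>M borel"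
    by measurable
  then show ?thesis by (simp add: case_prod_beta)
qed

lemma mix_point_prob_dists: "mix_point p a Q \<in> prob_dists"
proof -
  note [simp, measurable_cong] = sets_prob_dists
  note [measurable] = mix_point_measurable
  interpret Q: prob_space Q by (rule prob_dists_prob_space)
  interpret pair_prob_space "measure_pmf (bernoulli_pmf p)" Q ..
  show ?thesis
    by (auto simp: prob_dists_def mix_point_def intro!: prob_space_distr)
qed

lemma nn_integral_mix_point:
  assumes p: "0 \<le> p" "p \<le> 1" and [measurable]: "f \<in> borel_measurable borel"
  shows "(\<integral>\<^sup>+x. f x \<partial>mix_point p a Q) = ennreal (1 - p) * f a + ennreal p * (\<integral>\<^sup>+x. f x \<partial>Q)"
proof -
  note [simp, measurable_cong] = sets_prob_dists
  note [measurable] = mix_point_measurable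
  interpret Q: prob_space Q by (rule prob_dists_prob_space)
  have "(\<integral>\<^sup>+x. f x \<partial>mix_point p a Q) =
      (\<integral>\<^sup>+b. \<integral>\<^sup>+x. f (if b then x else a) \<partial>Q \<partial>measure_pmf (bernoulli_pmf p))"
    unfolding mix_point_def by (simp add: nn_integral_distr Q.nn_integral_fst[symmetric])
  also have "\<dots> = ennreal (1 - p) * f a + ennreal p * (\<integral>\<^sup>+x. f x \<partial>Q)"
    using p Q.emeasure_space_1 by (simp add: ac_simps)
  finally show ?thesis .
qed

lemma char_mix_point:
  assumes p: "0 \<le> p" "p \<le> 1"
  shows "char (mix_point p a Q) t = (1 - p) * iexp (t * a) + p * char Q t"
proof -
  note [simp, measurable_cong] = sets_prob_dists
  note [measurable] = mix_point_measurable
  interpret Q: prob_space Q by (rule prob_dists_prob_space)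
  interpret P: pair_prob_space "measure_pmf (bernoulli_pmf p)" Q ..
  let ?f = "\<lambda>z. iexp (t * (case z of (b, x) \<Rightarrow> if b then x else a))"
  have "integrable (measure_pmf (bernoulli_pmf p) \<Otimes>\<^sub>M Q) ?f"
  proof (rule P.integrable_const_bound[where B = 1])
    show "AE z in measure_pmf (bernoulli_pmf p) \<Otimes>\<^sub>M Q. cmod (?f z) \<le> 1" by (simp add: norm_exp_i_times)
    show "?f \<in> borel_measurable (measure_pmf (bernoulli_pmf p) \<Otimes>\<^sub>M Q)"
      by (rule measurable_compose[OF mix_point_measurable, of "\<lambda>x. iexp (t * x)"]) measurable
  qed
  then have "char (mix_point p a Q) t =
     (CLINT b|measure_pmf (bernoulli_pmf p). CLINT x|Q. ?f (b, x))"
    unfolding char_def mix_point_def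
    by (subst P.integral_fst') (simp_all add: integral_distr)
  also have "\<dots> = (\<Sum>b\<in>UNIV. pmf (bernoulli_pmf p) b *\<^sub>R (CLINT x|Q. ?f (b, x)))"
    by (rule integral_measure_pmf) auto
  also have "\<dots> = (1 - p) * iexp (t * a) + p * char Q t"
    using p Q.prob_space by (simp add: UNIV_bool char_def scaleR_conv_of_real)
  finally show ?thesis by simp
qed

lemma char_convolution_gauss:
  assumes "\<sigma> > 0"
  shows "char (Q \<star> gauss 0 \<sigma>) t = char Q t * char (gauss 0 \<sigma>) t"
proof -
  note [simp, measurable_cong] = sets_prob_dists
  note [measurable] = mix_point_measurable
  interpret Q: prob_space Q by (rule prob_dists_prob_space)
  interpret G: prob_space "gauss 0 \<sigma>" using assms by (intro prob_space_normal_density)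
  interpret P: pair_prob_space Q "gauss 0 \<sigma>" ..
  have "integrable (Q \<Otimes>\<^sub>M gauss 0 \<sigma>) (\<lambda>z. iexp (t * (fst z + snd z)))"
    by (rule P.integrable_const_bound[where B = 1]) (simp_all add: norm_exp_i_times)
  then have "char (Q \<star> gauss 0 \<sigma>) t = (CLINT x|Q. CLINT y|gauss 0 \<sigma>. iexp (t * (x + y)))"
    unfolding char_def convolution_def
    by (simp add: integral_distr case_prod_beta' P.integral_fst'[symmetric])
  also have "\<dots> = (CLINT x|Q. iexp (t * x) * char (gauss 0 \<sigma>) t)"
    by (simp add: char_def ring_distribs exp_add)
  finally show ?thesis by (simp add: char_def)
qed

end

lemma gauss_scale:
  assumes "\<sigma> > 0"
  shows "gauss \<theta> \<sigma> = distr std_normal_distribution borel (\<lambda>x. \<theta> + \<sigma> * x)"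
proof -
  interpret prob_space std_normal_distribution by (rule prob_space_normal_density) simp
  have "distributed std_normal_distribution lborel (\<lambda>x. x) std_normal_density"
    by (simp add: distributed_def distr_id2)
  from normal_density_affine[OF this, of \<sigma> \<theta>] assms
  have "distr std_normal_distribution lborel (\<lambda>x. \<theta> + \<sigma> * x) = gauss \<theta> \<sigma>"
    by (simp add: distributed_def)
  moreover have "distr std_normal_distribution lborel (\<lambda>x. \<theta> + \<sigma> * x) =
      distr std_normal_distribution borel (\<lambda>x. \<theta> + \<sigma> * x)"
    by (rule distr_cong) auto
  ultimately show ?thesis by simp
qed

lemma gauss_shift:
  assumes "\<sigma> > 0" and [measurable]: "A \<in> sets borel"
  shows "(\<integral>\<^sup>+y. indicator A (\<theta> + y) \<partial>gauss 0 \<sigma>) = emeasure (gauss \<theta> \<sigma>) A"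
proof -
  have "(\<integral>\<^sup>+y. indicator A (\<theta> + y) \<partial>gauss 0 \<sigma>) =
     (\<integral>\<^sup>+y. indicator A (\<theta> + \<sigma> * y) \<partial>std_normal_distribution)"
    using assms(1) by (simp add: gauss_scale[of \<sigma> 0] nn_integral_distr)
  also have "\<dots> = (\<integral>\<^sup>+y. indicator A y \<partial>gauss \<theta> \<sigma>)"
    unfolding gauss_scale[OF assms(1), of \<theta>] by (simp add: nn_integral_distr del: nn_integral_indicator)
  finally show ?thesis by simp
qed

lemma char_gauss_centred:
  assumes "\<sigma> > 0"
  shows "char (gauss 0 \<sigma>) t = exp (- (\<sigma>\<^sup>2 * t\<^sup>2 / 2))"
proof -
  have "char (gauss 0 \<sigma>) t = char std_normal_distribution (t * \<sigma>)"
    unfolding gauss_scale[OF assms] char_def by (simp add: integral_distr mult.assoc)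
  then show ?thesis
    by (simp add: char_std_normal_distribution power_mult_distrib mult.commute flip: exp_of_real)
qed

lemma emeasure_convolution_gauss:
  assumes "\<sigma> > 0" "Q \<in> prob_dists" and [measurable]: "A \<in> sets borel"
  shows "emeasure (Q \<star> gauss 0 \<sigma>) A = (\<integral>\<^sup>+x. emeasure (gauss x \<sigma>) A \<partial>Q)"
proof -
  interpret Q: prob_space Q using assms by (simp add: prob_dists_def)
  interpret G: prob_space "gauss 0 \<sigma>" using assms by (intro prob_space_normal_density)
  have [simp]: "sets Q = sets borel" using assms by (simp add: prob_dists_def)
  have "emeasure (Q \<star> gauss 0 \<sigma>) A = (\<integral>\<^sup>+x. \<integral>\<^sup>+y. indicator A (x + y) \<partial>gauss 0 \<sigma> \<partial>Q)"
    by (rule convolution_emeasure') (simp_all add: Q.finite_measure_axioms G.finite_measure_axioms)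
  then show ?thesis using assms(1) by (simp add: gauss_shift)
qed

lemma measurable_emeasure_gauss:
  assumes "\<sigma> > 0" and [measurable]: "A \<in> sets borel"
  shows "(\<lambda>x. emeasure (gauss x \<sigma>) A) \<in> borel_measurable borel"
proof -
  interpret G: prob_space "gauss 0 \<sigma>" using assms by (intro prob_space_normal_density)
  have "(\<lambda>(x, y). indicator A (x + y) :: ennreal) \<in> borel_measurable (borel \<Otimes>\<^sub>M gauss 0 \<sigma>)"
    by measurable
  then have "(\<lambda>x. \<integral>\<^sup>+y. indicator A (x + y) \<partial>gauss 0 \<sigma>) \<in> borel_measurable borel"
    by (rule G.borel_measurable_nn_integral)
  then show ?thesis using assms by (simp add: gauss_shift)
qed

text \<open>
  The null component is itself a Gaussian smoothing, namely of the point mass at \<open>\<theta>\<close>, so the whole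
  model is one distribution of means smoothed once. This gives its characteristic function as a
  product.
\<close>

lemma two_groups_eq_convolution:
  assumes "\<sigma> > 0" "0 \<le> \<epsilon>" "\<epsilon> \<le> 1" "Q \<in> prob_dists"
  shows "two_groups \<theta> \<sigma> \<epsilon> Q = (mix_point \<epsilon> \<theta> Q \<star> gauss 0 \<sigma>)"
proof (rule measure_eqI)
  fix A assume "A \<in> sets (two_groups \<theta> \<sigma> \<epsilon> Q)"
  then have [measurable]: "A \<in> sets borel" by simp
  show "emeasure (two_groups \<theta> \<sigma> \<epsilon> Q) A = emeasure (mix_point \<epsilon> \<theta> Q \<star> gauss 0 \<sigma>) A"
    apply (subst emeasure_two_groups, fact)
    apply (subst emeasure_convolution_gauss[OF assms(1,4)], fact)
    apply (subst emeasure_convolution_gauss[OF assms(1) mix_point_prob_dists[OF assms(4)]], fact)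
    apply (subst nn_integral_mix_point[OF assms(4,2,3) measurable_emeasure_gauss[OF assms(1)]], fact)
    apply (rule refl) done
qed simp

text \<open>
  Contamination of level \<open>\<epsilon>\<close> is also contamination of any higher level: the surplus is spent on
  signals whose mean happens to be \<open>\<theta>\<close>. This transfers the guarantee of the pilot estimator, given at
  the maximal level only, to every smaller level.
\<close>

lemma two_groups_inflate:
  assumes "\<sigma> > 0" "0 \<le> \<epsilon>" "\<epsilon> \<le> \<epsilon>'" "0 < \<epsilon>'" "\<epsilon>' \<le> 1" "Q \<in> prob_dists"
  shows "two_groups \<theta> \<sigma> \<epsilon>' (mix_point (\<epsilon> / \<epsilon>') \<theta> Q) = two_groups \<theta> \<sigma> \<epsilon> Q"
proof (rule measure_eqI)
  fix A assume "A \<in> sets (two_groups \<theta> \<sigma> \<epsilon>' (mix_point (\<epsilon> / \<epsilon>') \<theta> Q))"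
  then have [measurable]: "A \<in> sets borel" by simp
  let ?G = "emeasure (gauss \<theta> \<sigma>) A" and ?q = "emeasure (Q \<star> gauss 0 \<sigma>) A"
  have p: "0 \<le> \<epsilon> / \<epsilon>'" "\<epsilon> / \<epsilon>' \<le> 1" using assms by auto
  have "emeasure (two_groups \<theta> \<sigma> \<epsilon>' (mix_point (\<epsilon> / \<epsilon>') \<theta> Q)) A =
      ennreal (1 - \<epsilon>') * ?G + ennreal \<epsilon>' * (ennreal (1 - \<epsilon> / \<epsilon>') * ?G + ennreal (\<epsilon> / \<epsilon>') * ?q)"
    using assms p by (simp add: emeasure_two_groups emeasure_convolution_gauss mix_point_prob_dists
      nn_integral_mix_point measurable_emeasure_gauss)
  also have "\<dots> = (ennreal (1 - \<epsilon>') + ennreal \<epsilon>' * ennreal (1 - \<epsilon> / \<epsilon>')) * ?G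
                  + (ennreal \<epsilon>' * ennreal (\<epsilon> / \<epsilon>')) * ?q"
    by (simp add: ring_distribs mult.assoc add.assoc)
  also have "ennreal \<epsilon>' * ennreal (\<epsilon> / \<epsilon>') = ennreal \<epsilon>"
    using assms by (simp flip: ennreal_mult)
  also have "ennreal (1 - \<epsilon>') + ennreal \<epsilon>' * ennreal (1 - \<epsilon> / \<epsilon>') = ennreal (1 - \<epsilon>)"
    using assms p by (simp add: field_simps flip: ennreal_mult ennreal_plus)
  finally show "emeasure (two_groups \<theta> \<sigma> \<epsilon>' (mix_point (\<epsilon> / \<epsilon>') \<theta> Q)) A = emeasure (two_groups \<theta> \<sigma> \<epsilon> Q) A"
    using assms by (simp add: emeasure_two_groups)
qed simp

text \<open>
  Dividing by the characteristic function of the null leaves \<open>(1 - \<epsilon>) + \<epsilon> \<psi>(t)\<close>, where \<open>\<psi>\<close> is the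
  characteristic function of \<open>Q\<close> translated by \<open>-\<theta>\<close> and hence of modulus at most one.
\<close>

lemma recentred_char_two_groups:
  assumes "\<sigma> > 0" "0 \<le> \<epsilon>" "\<epsilon> \<le> 1" "Q \<in> prob_dists"
  shows "cmod (exp (- \<i> * of_real \<theta> * of_real t + of_real (\<sigma>\<^sup>2 * t\<^sup>2 / 2)) *
           char (two_groups \<theta> \<sigma> \<epsilon> Q) t - (1 - \<epsilon>)) \<le> \<epsilon>"
proof -
  interpret Q: real_distribution Q
    using assms by (simp add: prob_dists_def real_distribution_def real_distribution_axioms_def)
  define w where "w = \<sigma>\<^sup>2 * t\<^sup>2 / 2"
  let ?r = "exp (- (\<i> * \<theta> * t))" and ?e = "exp (- \<i> * of_real \<theta> * of_real t + of_real w)"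
  have "?e * char (two_groups \<theta> \<sigma> \<epsilon> Q) t =
     (?r * exp w) * (((1 - \<epsilon>) * iexp (t * \<theta>) + \<epsilon> * char Q t) * exp (- w))"
    unfolding exp_add using assms
    by (simp add: two_groups_eq_convolution char_convolution_gauss mix_point_prob_dists
      char_mix_point char_gauss_centred exp_of_real w_def[symmetric] del: of_real_exp)
  also have "\<dots> = (exp w * exp (- w)) * ((1 - \<epsilon>) * (?r * iexp (t * \<theta>)) + \<epsilon> * (?r * char Q t))"
    by (simp add: algebra_simps)
  also have "?r * iexp (t * \<theta>) = 1"
    by (simp add: mult.commute mult.left_commute flip: exp_add)
  also have "complex_of_real (exp w * exp (- w)) = 1"
    by (simp flip: exp_add of_real_mult)
  finally have eq: "?e * char (two_groups \<theta> \<sigma> \<epsilon> Q) t - (1 - \<epsilon>) = \<epsilon> * (?r * char Q t)"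
    by simp
  have "cmod (exp (- (\<i> * \<theta> * t))) = 1"
    by (simp add: norm_exp_eq_Re)
  then show ?thesis
    unfolding w_def[symmetric] eq using Q.cmod_char_le_1[of t] assms(2) by (simp add: norm_mult mult_left_le)
qed

section \<open>Rotations of a disc inside the unit circle\<close>

text \<open>
  Jordan's inequality for the sine, a consequence of its concavity, through the half-angle formula.
\<close>

lemma jordan_cos:
  fixes x :: real
  assumes "\<bar>x\<bar> \<le> pi"
  shows "2 * (x / pi)\<^sup>2 \<le> 1 - cos x"
proof -
  have "concave_on {0..pi/2} sin"
    by (rule f''_le0_imp_concave[where f' = cos and f'' = "\<lambda>x. - sin x"])
       (auto intro!: derivative_eq_intros simp: sin_ge_zero)
  then have conc: "(1 - u) * sin 0 + u * sin (pi / 2) \<le> sin ((1 - u) *\<^sub>R 0 + u *\<^sub>R (pi / 2))"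
    if "0 \<le> u" "u \<le> 1" for u
    using that by (intro concave_onD) auto
  define u where "u = \<bar>x\<bar> / pi"
  have u: "0 \<le> u" "u \<le> 1" using assms by (auto simp: u_def field_simps)
  have "u \<le> sin (\<bar>x\<bar> / 2)"
    using conc[OF u] by (simp add: u_def)
  then have "u\<^sup>2 \<le> (sin (\<bar>x\<bar> / 2))\<^sup>2" using u by (intro power_mono)
  also have "(sin (\<bar>x\<bar> / 2))\<^sup>2 = (1 - cos x) / 2"
    using cos_double_sin[of "\<bar>x\<bar> / 2"] by simp
  finally have "2 * u\<^sup>2 \<le> 1 - cos x" by simp
  then show ?thesis by (simp add: u_def power_divide)
qed

text \<open>
  The disc \<open>\<bar>2 z - 1\<bar> \<le> 1\<close> contains the disc of radius \<open>\<epsilon>\<close> around \<open>1 - \<epsilon>\<close>, and both touch the unit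
  circle from inside at \<open>1\<close> only. For small \<open>\<epsilon>\<close> a point of the smaller disc is close to \<open>1\<close>, and a
  rotation that does not move it far out of the larger disc must have a small angle. Squaring turns the hypothesis into
  \<open>\<bar>z\<bar>\<^sup>2 - Re (e\<^sup>-\<^sup>i\<^sup>x z) \<le> D + D\<^sup>2\<close>; the terms that do not involve \<open>1 - cos x\<close> are of order \<open>\<epsilon>\<close>.
\<close>

lemma rotation_bound:
  fixes z :: complex and x \<epsilon> D :: real
  assumes z: "cmod (z - (1 - \<epsilon>)) \<le> \<epsilon>" and \<epsilon>: "\<epsilon> \<le> 1/2"
    and rot: "cmod (2 * cis (- x) * z - 1) \<le> 1 + 2 * D" and "D \<ge> 0"
  shows "(1 - 2 * \<epsilon>) * (1 - cos x) \<le> 3 * \<epsilon> + D + D\<^sup>2"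
proof -
  obtain u v where zuv: "z = Complex u v" by (cases z)
  have "Re (z - (1 - \<epsilon>)) \<le> \<epsilon>" "- Re (z - (1 - \<epsilon>)) \<le> \<epsilon>" "\<bar>Im (z - (1 - \<epsilon>))\<bar> \<le> \<epsilon>"
    using abs_Re_le_cmod[of "z - (1 - \<epsilon>)"] abs_Im_le_cmod[of "z - (1 - \<epsilon>)"] z by auto
  then have u: "u \<le> 1" "1 - 2 * \<epsilon> \<le> u" and v: "\<bar>v\<bar> \<le> \<epsilon>" by (auto simp: zuv)
  have u0: "u \<ge> 0" using u \<epsilon> by simp
  have "(cmod (2 * cis (- x) * z - 1))\<^sup>2 \<le> (1 + 2 * D)\<^sup>2"
    using rot by (intro power_mono) auto
  moreover have "(cmod (2 * cis (- x) * z - 1))\<^sup>2 =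
      4 * (u\<^sup>2 + v\<^sup>2) - 4 * (u * cos x + v * sin x) + 1"
  proof -
    have expand: "(2 * (c * u + s * v) - 1)\<^sup>2 + (2 * (c * v - s * u))\<^sup>2 =
        4 * (u\<^sup>2 + v\<^sup>2) * (s\<^sup>2 + c\<^sup>2) - 4 * (u * c + v * s) + 1" for c s :: real
      by (simp add: power2_eq_square algebra_simps)
    have "(cmod (2 * cis (- x) * z - 1))\<^sup>2 =
        (2 * (cos x * u + sin x * v) - 1)\<^sup>2 + (2 * (cos x * v - sin x * u))\<^sup>2"
      by (simp add: cmod_power2 zuv algebra_simps)
    then show ?thesis by (simp only: expand sin_cos_squared_add mult_1_right)
  qed
  ultimately have main: "u\<^sup>2 + v\<^sup>2 - (u * cos x + v * sin x) \<le> D + D\<^sup>2"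
    by (simp add: power2_eq_square algebra_simps)
  have "v * sin x \<le> \<bar>v\<bar> * \<bar>sin x\<bar>"
    by (simp flip: abs_mult)
  also have "\<dots> \<le> \<epsilon> * 1"
    using v by (intro mult_mono) auto
  finally have sinv: "v * sin x \<le> \<epsilon>" by simp
  have uu: "u - u\<^sup>2 \<le> 2 * \<epsilon>"
  proof -
    have "u * (1 - u) \<le> 1 * (1 - u)" using u by (intro mult_right_mono) auto
    then show ?thesis using u by (simp add: power2_eq_square algebra_simps)
  qed
  have "(1 - 2 * \<epsilon>) * (1 - cos x) \<le> u * (1 - cos x)"
    using u by (intro mult_right_mono) auto
  also have "u * (1 - cos x) = u - u * cos x" by (simp add: right_diff_distrib)
  also have "\<dots> \<le> 3 * \<epsilon> + D + D\<^sup>2"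
    using main sinv uu zero_le_power2[of v] by linarith
  finally show ?thesis .
qed

section \<open>Deviations of the empirical characteristic function\<close>

lemma indep_vars_PiM_coordinates:
  assumes P: "prob_space P" and I: "finite I" "I \<noteq> {}"
  shows "prob_space.indep_vars (\<Pi>\<^sub>M i\<in>I. P) (\<lambda>_. P) (\<lambda>i X. X i) I"
proof -
  interpret prob_space "\<Pi>\<^sub>M i\<in>I. P" by (intro prob_space_PiM P)
  have "distr (\<Pi>\<^sub>M i\<in>I. P) (\<Pi>\<^sub>M i\<in>I. P) (\<lambda>x. \<lambda>i\<in>I. x i) = (\<Pi>\<^sub>M i\<in>I. P)"
    by (rule trans[OF distr_cong distr_id]) (auto simp: space_PiM)
  also have "\<dots> = (\<Pi>\<^sub>M i\<in>I. distr (\<Pi>\<^sub>M i\<in>I. P) P (\<lambda>X. X i))"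
    by (intro PiM_cong refl distr_PiM_component[symmetric] P)
  finally show ?thesis
    by (subst indep_vars_iff_distr_eq_PiM') (use I in auto)
qed

text \<open>
  Hoeffding's inequality for values in an interval of length two, transported to the coordinates of a
  product space.
\<close>

lemma sample_mean_deviation:
  fixes g :: "real \<Rightarrow> real" and n :: nat and a :: real
  assumes P: "real_distribution P" and n: "n \<ge> 1" and a: "a \<ge> 0"
    and [measurable]: "g \<in> borel_measurable borel" and g: "\<And>x. \<bar>g x\<bar> \<le> 1"
  shows "measure (\<Pi>\<^sub>M j\<in>{1..n}. P)
      {X \<in> space (\<Pi>\<^sub>M j\<in>{1..n}. P). a \<le> \<bar>(\<Sum>j=1..n. g (X j)) / n - (LINT x|P. g x)\<bar>}
    \<le> 2 * exp (- (n * a\<^sup>2 / 2))"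
proof -
  interpret P: real_distribution P by fact
  let ?M = "\<Pi>\<^sub>M j\<in>{1..n}. P"
  have ne: "{1..n} \<noteq> {}" using n by auto
  have gb: "g x \<in> {-1..1}" for x using g[of x] by auto
  interpret prob_space ?M by (intro prob_space_PiM P.prob_space_axioms)
  have "indep_vars (\<lambda>_. borel) (\<lambda>j X. g (X j)) {1..n}"
    by (rule indep_vars_compose2[OF indep_vars_PiM_coordinates[OF P.prob_space_axioms _ ne]])
       simp_all
  then interpret H: indep_interval_bounded_random_variables ?M "{1..n}"
      "\<lambda>j X. g (X j)" "\<lambda>_. - 1" "\<lambda>_. 1"
    by unfold_locales (use gb in auto)
  have mean: "expectation (\<lambda>X. g (X j)) = (LINT x|P. g x)" if j: "j \<in> {1..n}" for j
  proof -
    have "(LINT x|P. g x) = (LINT x|distr ?M P (\<lambda>X. X j). g x)"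
      by (subst distr_PiM_component) (use j P.prob_space_axioms in auto)
    then show ?thesis using j by (simp add: integral_distr)
  qed
  interpret H: Hoeffding_ineq ?M "{1..n}" "\<lambda>j X. g (X j)" "\<lambda>_. - 1" "\<lambda>_. 1" "n * (LINT x|P. g x)"
    by unfold_locales (simp add: mean del: One_nat_def)
  have "{X \<in> space ?M. a \<le> \<bar>(\<Sum>j=1..n. g (X j)) / n - (LINT x|P. g x)\<bar>} =
      {X \<in> space ?M. n * a \<le> \<bar>(\<Sum>j=1..n. g (X j)) - n * (LINT x|P. g x)\<bar>}"
  proof (intro Collect_cong conj_cong refl)
    fix X
    have "\<bar>(\<Sum>j=1..n. g (X j)) - n * (LINT x|P. g x)\<bar> =
        n * \<bar>(\<Sum>j=1..n. g (X j)) / n - (LINT x|P. g x)\<bar>"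
      using n by (simp add: abs_mult_pos' right_diff_distrib)
    then show "a \<le> \<bar>(\<Sum>j=1..n. g (X j)) / n - (LINT x|P. g x)\<bar> \<longleftrightarrow>
        n * a \<le> \<bar>(\<Sum>j=1..n. g (X j)) - n * (LINT x|P. g x)\<bar>"
      using n by simp
  qed
  also have "prob \<dots> \<le> 2 * exp (- 2 * (n * a)\<^sup>2 / (\<Sum>j\<in>{1..n}. (1 - (- 1))\<^sup>2))"
    by (rule H.Hoeffding_ineq_abs_ge) (use n a in auto)
  also have "- 2 * (n * a)\<^sup>2 / (\<Sum>j\<in>{1..n}. (1 - (- 1))\<^sup>2) = - (n * a\<^sup>2 / 2)"
    using n by (simp add: power2_eq_square field_simps)
  finally show ?thesis .
qed

lemma measurable_emp_char [measurable]:
  "(\<lambda>X. emp_char n X t) \<in> borel_measurable (\<Pi>\<^sub>M j\<in>{1..n}. borel)"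
  unfolding emp_char_def by measurable

text \<open>
  If the modulus of the error exceeds \<open>A\<close>, then its real or its imaginary part is at least \<open>A / 2\<close>, and
  these are deviations of sample means of cosines and sines.
\<close>

lemma emp_char_deviation:
  assumes P: "real_distribution P" and n: "n \<ge> 1" and A: "A \<ge> 0"
  shows "measure (\<Pi>\<^sub>M j\<in>{1..n}. P)
      {X \<in> space (\<Pi>\<^sub>M j\<in>{1..n}. P). A < cmod (emp_char n X t - char P t)}
    \<le> 4 * exp (- (n * A\<^sup>2 / 8))"
proof -
  interpret P: real_distribution P by fact
  let ?M = "\<Pi>\<^sub>M j\<in>{1..n}. P"
  interpret prob_space ?M by (intro prob_space_PiM P.prob_space_axioms)
  define E where "E g = {X \<in> space ?M. A / 2 \<le> \<bar>(\<Sum>j=1..n. g (X j)) / n - (LINT x|P. g x)\<bar>}"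
    for g :: "real \<Rightarrow> real"
  let ?c = "\<lambda>x. cos (t * x)" and ?s = "\<lambda>x. sin (t * x)"
  have "{X \<in> space ?M. A < cmod (emp_char n X t - char P t)} \<subseteq> E ?c \<union> E ?s"
  proof
    fix X assume X: "X \<in> {X \<in> space ?M. A < cmod (emp_char n X t - char P t)}"
    let ?z = "emp_char n X t - char P t"
    have int: "complex_integrable P (\<lambda>x. iexp (t * x))"
      by (rule P.integrable_const_bound[where B = 1]) (simp_all add: norm_exp_i_times)
    have "Re (emp_char n X t) = (\<Sum>j=1..n. ?c (X j)) / n" "Im (emp_char n X t) = (\<Sum>j=1..n. ?s (X j)) / n"
      unfolding emp_char_def by (simp_all add: Re_divide_of_nat Im_divide_of_nat Re_exp Im_exp)
    moreover have "Re (char P t) = (LINT x|P. ?c x)" "Im (char P t) = (LINT x|P. ?s x)"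
      unfolding char_def using int by (simp_all add: Re_exp Im_exp flip: integral_Re integral_Im)
    moreover have "A < \<bar>Re ?z\<bar> + \<bar>Im ?z\<bar>" using X cmod_le[of ?z] by auto
    then have "A / 2 \<le> \<bar>Re ?z\<bar> \<or> A / 2 \<le> \<bar>Im ?z\<bar>" by linarith
    ultimately show "X \<in> E ?c \<union> E ?s" using X by (auto simp: E_def)
  qed
  then have "prob {X \<in> space ?M. A < cmod (emp_char n X t - char P t)} \<le> prob (E ?c \<union> E ?s)"
    by (rule finite_measure_mono) (simp add: E_def)
  also have "\<dots> \<le> prob (E ?c) + prob (E ?s)"
    by (rule measure_Un_le) (simp_all add: E_def)
  also have "\<dots> \<le> 2 * exp (- (n * (A / 2)\<^sup>2 / 2)) + 2 * exp (- (n * (A / 2)\<^sup>2 / 2))"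
    unfolding E_def by (intro add_mono sample_mean_deviation[OF P n, of "A / 2" ?c]
      sample_mean_deviation[OF P n, of "A / 2" ?s]) (use A in auto)
  finally show ?thesis by (simp add: power_divide)
qed

section \<open>Measurability of the length of a random set\<close>

text \<open>
  An existential quantifier over an uncountable set does not preserve measurability in general. Over a
  compact set it does: a continuous function attains its infimum, so a nonpositive value exists as
  soon as values below every \<open>1 / (k + 1)\<close> exist, and those can be sought in a countable dense subset.
\<close>

lemma measurable_compact_projection:
  fixes h :: "'x \<Rightarrow> 's::{metric_space, second_countable_topology} \<Rightarrow> real"
  assumes "compact S"
    and cont: "\<And>x. x \<in> space M \<Longrightarrow> continuous_on S (h x)"
    and meas: "\<And>s. s \<in> S \<Longrightarrow> (\<lambda>x. h x s) \<in> borel_measurable M"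
  shows "{x \<in> space M. \<exists>s\<in>S. h x s \<le> 0} \<in> sets M"
proof (cases "S = {}")
  case False
  obtain D where D: "countable D" "D \<subseteq> S" "S \<subseteq> closure D"
    using separable by blast
  have "{x \<in> space M. \<exists>s\<in>S. h x s \<le> 0} =
      {x \<in> space M. \<forall>k::nat. \<exists>s\<in>D. h x s < 1 / Suc k}"
  proof (intro Collect_cong conj_cong refl iffI allI)
    fix x k assume x: "x \<in> space M" and "\<exists>s\<in>S. h x s \<le> 0"
    then obtain s where s: "s \<in> S" "h x s \<le> 0" by auto
    have "closedin (top_of_set S) {s\<in>S. h x s \<in> {1 / Suc k..}}"
      by (rule continuous_closedin_preimage[OF cont[OF x], simplified vimage_def Int_def mem_Collect_eq]) auto
    then obtain T where T: "closed T" "{s\<in>S. h x s \<ge> 1 / Suc k} = S \<inter> T"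
      by (auto simp: closedin_closed)
    show "\<exists>s\<in>D. h x s < 1 / Suc k"
    proof (rule ccontr)
      assume "\<not> (\<exists>s\<in>D. h x s < 1 / Suc k)"
      then have "D \<subseteq> T" using D T(2) by fastforce
      then have "s \<in> T" using D(3) s(1) closure_minimal[OF _ T(1)] by blast
      then have "h x s \<ge> 1 / Suc k" using T(2) s(1) by blast
      moreover have "1 / real (Suc k) > 0" by simp
      ultimately show False using s(2) by linarith
    qed
  next
    fix x assume x: "x \<in> space M" and ap: "\<forall>k::nat. \<exists>s\<in>D. h x s < 1 / Suc k"
    obtain s where s: "s \<in> S" "\<And>y. y \<in> S \<Longrightarrow> h x s \<le> h x y"
      using continuous_attains_inf[OF assms(1) False cont[OF x]] by blast
    have "h x s \<le> 0"
    proof (rule ccontr)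
      assume "\<not> h x s \<le> 0"
      then obtain k where "1 / Suc k < h x s" using nat_approx_posE[of "h x s"] by auto
      then show False using ap s(2) D(2) by (meson less_asym less_le_trans subsetD)
    qed
    then show "\<exists>s\<in>S. h x s \<le> 0" using s(1) by blast
  qed
  also have "\<dots> \<in> sets M"
    using D meas by (intro sets.sets_Collect_countable_All sets.sets_Collect_countable_Ex'
      borel_measurable_less) auto
  finally show ?thesis .
qed simp

lemma set_length_le_iff:
  assumes "K \<noteq> {}" "bounded K"
  shows "set_length K \<le> b \<longleftrightarrow> (\<forall>x\<in>K. \<forall>y\<in>K. y - x \<le> b)"
proof -
  have bdd: "bdd_above K" "bdd_below K"
    using assms(2) by (auto intro: bounded_imp_bdd_above bounded_imp_bdd_below)
  have "set_length K \<le> b \<longleftrightarrow> Sup K \<le> b + Inf K" by (auto simp: set_length_def)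
  also have "\<dots> \<longleftrightarrow> (\<forall>y\<in>K. y - b \<le> Inf K)"
    using cSup_le_iff[OF assms(1) bdd(1)] by (auto simp: algebra_simps)
  also have "\<dots> \<longleftrightarrow> (\<forall>y\<in>K. \<forall>x\<in>K. y - b \<le> x)"
    using le_cInf_iff[OF assms(1) bdd(2)] by auto
  finally show ?thesis by (auto simp: algebra_simps)
qed

text \<open>
  The length of a random set is an uncountable supremum, so the measurability of a bound on it needs an
  argument. The bound fails exactly if two points of the set are at distance at least \<open>b + 1 / (k + 1)\<close>
  for some \<open>k\<close>. Relative to the random centre \<open>c\<close>, such pairs range over a fixed compact set, and
  compact projection applies.
\<close>

lemma measurable_length_of_level_set:
  fixes c :: "'x \<Rightarrow> real" and h :: "'x \<Rightarrow> real \<Rightarrow> real" and w :: real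
  defines "K \<equiv> \<lambda>x. {\<mu> \<in> {c x - w .. c x + w}. h x \<mu> \<le> 0}"
  assumes c [measurable]: "c \<in> borel_measurable M"
    and cont: "\<And>x. continuous_on UNIV (h x)"
    and meas: "\<And>f. f \<in> borel_measurable M \<Longrightarrow> (\<lambda>x. h x (f x)) \<in> borel_measurable M"
    and h0: "\<And>x \<mu>. h x \<mu> \<ge> 0"
  shows "{x \<in> space M. \<theta> \<in> K x \<and> set_length (K x) \<le> b} \<in> sets M"
proof -
  define S where "S k = ({-w..w} \<times> {-w..w}) \<inter> {p :: real \<times> real. b + 1 / real (Suc k) \<le> snd p - fst p}" for k
  define g where "g x p = h x (c x + fst p) + h x (c x + snd p)" for x and p :: "real \<times> real"
  have cov: "{x \<in> space M. \<theta> \<in> K x} \<in> sets M"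
    unfolding K_def using meas[of "\<lambda>_. \<theta>"] by simp
  have "{x \<in> space M. \<exists>p\<in>S k. g x p \<le> 0} \<in> sets M" for k
  proof (rule measurable_compact_projection)
    show "compact (S k)"
      unfolding S_def by (intro compact_Int_closed compact_Times closed_Collect_le continuous_intros) auto
    show "continuous_on (S k) (g x)" for x
      unfolding g_def
      by (intro continuous_intros continuous_on_compose2[OF cont]) auto
    show "(\<lambda>x. g x p) \<in> borel_measurable M" for p
      unfolding g_def by (intro borel_measurable_add meas) measurable
  qed
  then have "{x \<in> space M. \<theta> \<in> K x} - (\<Union>k. {x \<in> space M. \<exists>p\<in>S k. g x p \<le> 0}) \<in> sets M"
    using cov by auto
  also have "{x \<in> space M. \<theta> \<in> K x} - (\<Union>k. {x \<in> space M. \<exists>p\<in>S k. g x p \<le> 0}) =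
      {x \<in> space M. \<theta> \<in> K x \<and> set_length (K x) \<le> b}"
  proof -
    have "set_length (K x) \<le> b \<longleftrightarrow> \<not> (\<exists>k. \<exists>p\<in>S k. g x p \<le> 0)" if \<theta>: "\<theta> \<in> K x" for x
    proof -
      have "bounded (K x)" unfolding K_def by (rule bounded_subset[OF bounded_closed_interval]) auto
      then have "set_length (K x) \<le> b \<longleftrightarrow> (\<forall>\<mu>\<in>K x. \<forall>\<nu>\<in>K x. \<nu> - \<mu> \<le> b)"
        using \<theta> by (intro set_length_le_iff) auto
      also have "\<dots> \<longleftrightarrow> \<not> (\<exists>k. \<exists>p\<in>S k. g x p \<le> 0)"
      proof (intro iffI notI)
        assume all: "\<forall>\<mu>\<in>K x. \<forall>\<nu>\<in>K x. \<nu> - \<mu> \<le> b" and "\<exists>k. \<exists>p\<in>S k. g x p \<le> 0"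
        then obtain k p where p: "p \<in> S k" "g x p \<le> 0" by auto
        have "h x (c x + fst p) \<le> 0" "h x (c x + snd p) \<le> 0"
          using p(2) h0[of x "c x + fst p"] h0[of x "c x + snd p"] by (auto simp: g_def)
        then have "c x + fst p \<in> K x" "c x + snd p \<in> K x" using p(1) by (auto simp: K_def S_def)
        then have "snd p - fst p \<le> b" using all by fastforce
        moreover have "b + 1 / real (Suc k) \<le> snd p - fst p" "1 / real (Suc k) > 0"
          using p(1) by (auto simp: S_def)
        ultimately show False by linarith
      next
        assume none: "\<not> (\<exists>k. \<exists>p\<in>S k. g x p \<le> 0)"
        show "\<forall>\<mu>\<in>K x. \<forall>\<nu>\<in>K x. \<nu> - \<mu> \<le> b"
        proof (intro ballI, rule ccontr)
          fix \<mu> \<nu> assume mem: "\<mu> \<in> K x" "\<nu> \<in> K x" and "\<not> \<nu> - \<mu> \<le> b"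
          then obtain k where "1 / real (Suc k) < \<nu> - \<mu> - b"
            using nat_approx_posE[of "\<nu> - \<mu> - b"] by auto
          then have "(\<mu> - c x, \<nu> - c x) \<in> S k" "g x (\<mu> - c x, \<nu> - c x) \<le> 0"
            using mem by (auto simp: K_def S_def g_def)
          then show False using none by blast
        qed
      qed
      finally show ?thesis .
    qed
    then show ?thesis by blast
  qed
  finally show ?thesis .
qed

lemma measurable_Upsilon:
  assumes "f \<in> borel_measurable (\<Pi>\<^sub>M j\<in>{1..n}. borel)"
  shows "(\<lambda>X. Upsilon \<sigma> n X t (f X)) \<in> borel_measurable (\<Pi>\<^sub>M j\<in>{1..n}. borel)"
  unfolding Upsilon_def using assms by measurable

lemma finite_freqs [simp]: "finite (freqs \<kappa> \<sigma> n)"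
proof -
  have "freqs \<kappa> \<sigma> n = (\<lambda>k. sqrt (real k) * inverse (\<kappa> * \<sigma>)) ` {1..nat \<lceil>log_en n\<rceil>}"
    by (auto simp: freqs_def)
  then show ?thesis by simp
qed

lemma conf_set_event_measurable:
  assumes "\<tau> n \<in> borel_measurable (\<Pi>\<^sub>M j\<in>{1..n}. borel)"
  shows "{X \<in> space (\<Pi>\<^sub>M j\<in>{1..n}. borel). \<theta> \<in> conf_set \<delta> M \<kappa> \<sigma> \<tau> n X \<and>
            set_length (conf_set \<delta> M \<kappa> \<sigma> \<tau> n X) \<le> b} \<in> sets (\<Pi>\<^sub>M j\<in>{1..n}. borel)"
proof -
  \<comment> \<open>The finitely many constraints are merged into one nonnegative continuous function.\<close>
  define h where "h X \<mu> = (\<Sum>t\<in>freqs \<kappa> \<sigma> n. max 0 (cmod (Upsilon \<sigma> n X t \<mu>) - (1 + slack \<delta> \<kappa> \<sigma> n t)))" for X \<mu>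
  have h: "h X \<mu> \<le> 0 \<longleftrightarrow> (\<forall>t\<in>freqs \<kappa> \<sigma> n. cmod (Upsilon \<sigma> n X t \<mu>) \<le> 1 + slack \<delta> \<kappa> \<sigma> n t)" for X \<mu>
  proof -
    have "h X \<mu> \<ge> 0" unfolding h_def by (intro sum_nonneg) auto
    then have "h X \<mu> \<le> 0 \<longleftrightarrow> h X \<mu> = 0" by auto
    also have "\<dots> \<longleftrightarrow> (\<forall>t\<in>freqs \<kappa> \<sigma> n. max 0 (cmod (Upsilon \<sigma> n X t \<mu>) - (1 + slack \<delta> \<kappa> \<sigma> n t)) = 0)"
      unfolding h_def by (rule sum_nonneg_eq_0_iff) auto
    finally show ?thesis by (auto simp: max_def split: if_splits)
  qed
  have conf_set_eq: "conf_set \<delta> M \<kappa> \<sigma> \<tau> n X =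
      {\<mu> \<in> {\<tau> n X - M * \<sigma> / sqrt (log_en n) .. \<tau> n X + M * \<sigma> / sqrt (log_en n)}. h X \<mu> \<le> 0}" for X
    by (auto simp: conf_set_def pilot_CI_def h)
  show ?thesis
    unfolding conf_set_eq
  proof (rule measurable_length_of_level_set[OF assms])
    show "continuous_on UNIV (h X)" for X
      unfolding h_def Upsilon_def by (intro continuous_intros)
    show "h X \<mu> \<ge> 0" for X \<mu>
      unfolding h_def by (intro sum_nonneg) auto
    fix f :: "(nat \<Rightarrow> real) \<Rightarrow> real" assume "f \<in> borel_measurable (\<Pi>\<^sub>M j\<in>{1..n}. borel)"
    note [measurable] = measurable_Upsilon[OF this]
    show "(\<lambda>X. h X (f X)) \<in> borel_measurable (\<Pi>\<^sub>M j\<in>{1..n}. borel)"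
      unfolding h_def by measurable
  qed
qed

section \<open>Accepted candidates on the accuracy event\<close>

text \<open>
  The event on which the procedure succeeds. The factor on the left is the one by which an error of the
  empirical characteristic function is amplified in \<^const>\<open>Upsilon\<close>.
\<close>

definition char_accurate ::
    "real \<Rightarrow> real \<Rightarrow> real \<Rightarrow> nat \<Rightarrow> real measure \<Rightarrow> (nat \<Rightarrow> real) \<Rightarrow> bool" where
  "char_accurate \<delta> \<kappa> \<sigma> n P X \<longleftrightarrow> (\<forall>t\<in>freqs \<kappa> \<sigma> n.
     2 * exp (\<sigma>\<^sup>2 * t\<^sup>2 / 2) * cmod (emp_char n X t - char P t) \<le> slack \<delta> \<kappa> \<sigma> n t)"

text \<open>
  The second term on the left is the noiseless counterpart of \<^const>\<open>Upsilon\<close>, written as a rotation by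
  \<open>(\<mu> - \<theta>) t\<close> of its value at the true parameter.
\<close>

lemma Upsilon_error:
  "cmod (Upsilon \<sigma> n X t \<mu> - (2 * cis (- ((\<mu> - \<theta>) * t)) *
      (exp (- \<i> * of_real \<theta> * of_real t + of_real (\<sigma>\<^sup>2 * t\<^sup>2 / 2)) * \<phi>) - 1)) =
    2 * exp (\<sigma>\<^sup>2 * t\<^sup>2 / 2) * cmod (emp_char n X t - \<phi>)"
proof -
  have "cis (- ((\<mu> - \<theta>) * t)) * exp (- \<i> * of_real \<theta> * of_real t + of_real (\<sigma>\<^sup>2 * t\<^sup>2 / 2)) =
      exp (- \<i> * of_real \<mu> * of_real t + of_real (\<sigma>\<^sup>2 * t\<^sup>2 / 2))"
    by (simp add: cis_conv_exp algebra_simps flip: exp_add)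
  then have "Upsilon \<sigma> n X t \<mu> - (2 * cis (- ((\<mu> - \<theta>) * t)) *
      (exp (- \<i> * of_real \<theta> * of_real t + of_real (\<sigma>\<^sup>2 * t\<^sup>2 / 2)) * \<phi>) - 1) =
      2 * exp (- \<i> * of_real \<mu> * of_real t + of_real (\<sigma>\<^sup>2 * t\<^sup>2 / 2)) * (emp_char n X t - \<phi>)"
    by (simp add: Upsilon_def algebra_simps)
  then show ?thesis by (simp add: norm_mult norm_exp_eq_Re)
qed

text \<open>
  At \<open>\<mu> = \<theta>\<close> there is no rotation. The map \<open>z \<mapsto> 2 z - 1\<close> takes the disc of possible recentred
  characteristic functions into the unit disc because \<open>\<epsilon> \<le> 1 / 2\<close>, and sampling noise costs at most the slack.
\<close>

lemma coverage:
  assumes "\<sigma> > 0" "0 \<le> \<epsilon>" "\<epsilon> \<le> 1 / 2" "Q \<in> prob_dists"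
    and acc: "char_accurate \<delta> \<kappa> \<sigma> n (two_groups \<theta> \<sigma> \<epsilon> Q) X" and t: "t \<in> freqs \<kappa> \<sigma> n"
  shows "cmod (Upsilon \<sigma> n X t \<theta>) \<le> 1 + slack \<delta> \<kappa> \<sigma> n t"
proof -
  let ?z = "exp (- \<i> * of_real \<theta> * of_real t + of_real (\<sigma>\<^sup>2 * t\<^sup>2 / 2)) * char (two_groups \<theta> \<sigma> \<epsilon> Q) t"
  have "2 * ?z - 1 = 2 * (?z - (1 - \<epsilon>)) + of_real (1 - 2 * \<epsilon>)" by (simp add: algebra_simps)
  then have "cmod (2 * ?z - 1) \<le> cmod (2 * (?z - (1 - \<epsilon>))) + cmod (of_real (1 - 2 * \<epsilon>))"
    by (metis norm_triangle_ineq)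
  also have "\<dots> = 2 * cmod (?z - (1 - \<epsilon>)) + (1 - 2 * \<epsilon>)"
    unfolding norm_mult norm_of_real using assms by simp
  finally have "cmod (2 * ?z - 1) \<le> 1"
    using recentred_char_two_groups[of \<sigma> \<epsilon> Q \<theta> t] assms by auto
  moreover have "cmod (Upsilon \<sigma> n X t \<theta> - (2 * ?z - 1)) \<le> slack \<delta> \<kappa> \<sigma> n t"
    using Upsilon_error[of \<sigma> n X t \<theta> \<theta>] acc t by (simp add: char_accurate_def)
  ultimately show ?thesis
    using norm_triangle_sub[of "Upsilon \<sigma> n X t \<theta>" "2 * ?z - 1"] by linarith
qed

text \<open>
  Sampling noise uses up the slack once more than the acceptance rule does, hence the noiseless
  rotated point leaves the unit disc by at most twice the slack.
\<close>

lemma misfit_small: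
  assumes "\<sigma> > 0" "0 \<le> \<epsilon>" "\<epsilon> \<le> 1 / 2" "Q \<in> prob_dists"
    and acc: "char_accurate \<delta> \<kappa> \<sigma> n (two_groups \<theta> \<sigma> \<epsilon> Q) X" and t: "t \<in> freqs \<kappa> \<sigma> n"
    and D: "slack \<delta> \<kappa> \<sigma> n t = D" and ok: "cmod (Upsilon \<sigma> n X t \<mu>) \<le> 1 + D"
  shows "(1 - 2 * \<epsilon>) * (1 - cos ((\<mu> - \<theta>) * t)) \<le> 3 * \<epsilon> + D + D\<^sup>2"
proof (rule rotation_bound)
  let ?z = "exp (- \<i> * of_real \<theta> * of_real t + of_real (\<sigma>\<^sup>2 * t\<^sup>2 / 2)) * char (two_groups \<theta> \<sigma> \<epsilon> Q) t"
  show "cmod (?z - (1 - \<epsilon>)) \<le> \<epsilon>"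
    using recentred_char_two_groups[of \<sigma> \<epsilon> Q \<theta> t] assms by auto
  have err: "cmod (Upsilon \<sigma> n X t \<mu> - (2 * cis (- ((\<mu> - \<theta>) * t)) * ?z - 1)) \<le> D"
    using acc t unfolding Upsilon_error char_accurate_def D[symmetric] by blast
  then show "0 \<le> D" using norm_ge_zero order_trans by blast
  show "cmod (2 * cis (- ((\<mu> - \<theta>) * t)) * ?z - 1) \<le> 1 + 2 * D"
    using norm_triangle_sub[of "2 * cis (- ((\<mu> - \<theta>) * t)) * ?z - 1" "Upsilon \<sigma> n X t \<mu>"] err ok
    by (simp add: norm_minus_commute)
  show "\<epsilon> \<le> 1 / 2" by fact
qed

section \<open>Choice of the frequency and the rate\<close>

text \<open>
  A candidate at distance \<open>d\<close> is detected at frequency \<open>t\<close> through \<open>(d t)\<^sup>2\<close>, so large frequencies are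
  better, but the slack grows exponentially in \<open>t\<^sup>2\<close>. The choice \<open>k \<approx> l / 8\<close> gains the full factor \<open>l\<close>
  up to a constant, while \<open>exp (k / 2)\<close> stays below \<open>1 + \<epsilon> \<surd>n\<close> up to a constant, so that the slack is of
  order \<open>\<epsilon> + 1 / \<surd>n\<close>. The divisor \<open>8\<close> (any number above \<open>4\<close> would do for large \<open>n\<close>) leaves room for
  \<open>4 k \<le> log (e n)\<close>, which excludes rotations by more than half a turn. If \<open>\<epsilon> = 0\<close>, the
  logarithm takes its default value \<open>0\<close> and the maximum is \<open>1\<close>, as it should be.
\<close>

lemma frequency_choice:
  fixes \<epsilon> :: real and n :: nat
  assumes \<epsilon>: "0 \<le> \<epsilon>" "\<epsilon> \<le> 1" and n: "n \<ge> 1" and L: "log_en n \<ge> 8"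
  defines "l \<equiv> max 1 (ln (exp 1 * real n * \<epsilon>\<^sup>2))"
  obtains k :: nat where "1 \<le> k" "l / 8 \<le> k" "4 * real k \<le> log_en n" "k \<le> nat \<lceil>log_en n\<rceil>"
    "exp (k / 2) \<le> exp 1 * (1 + sqrt n * \<epsilon>)"
proof
  define k where "k = nat \<lceil>l / 8\<rceil>"
  have l1: "l \<ge> 1" by (simp add: l_def)
  have lL: "l \<le> log_en n"
  proof (cases "\<epsilon> = 0")
    case True then show ?thesis using L by (simp add: l_def)
  next
    case False
    then have "\<epsilon>\<^sup>2 > 0" "\<epsilon>\<^sup>2 \<le> 1" using \<epsilon> by (auto simp: power_le_one)
    then have "ln (exp 1 * real n * \<epsilon>\<^sup>2) \<le> ln (exp 1 * real n)"
      using n by (intro ln_mono) (auto simp: mult_left_le)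
    then show ?thesis using L by (simp add: l_def log_en_def)
  qed
  show kl: "l / 8 \<le> real k" unfolding k_def by linarith
  have k_le: "real k \<le> l / 8 + 1" using l1 unfolding k_def by linarith
  show "1 \<le> k" using kl l1 by (cases k) auto
  show k4: "4 * real k \<le> log_en n" using k_le lL L by linarith
  have "real k \<le> real_of_int \<lceil>log_en n\<rceil>" using k4 L by linarith
  then show "k \<le> nat \<lceil>log_en n\<rceil>" by linarith
  have "exp l \<le> exp 1 * (1 + real n * \<epsilon>\<^sup>2)"
  proof (cases "ln (exp 1 * real n * \<epsilon>\<^sup>2) \<le> 1")
    case True then show ?thesis by (simp add: l_def max_def algebra_simps)
  next
    case False
    then have "\<epsilon> \<noteq> 0" by auto
    then have "exp 1 * real n * \<epsilon>\<^sup>2 > 0" using n by simp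
    then have "exp l = exp 1 * real n * \<epsilon>\<^sup>2" using False by (simp add: l_def max_def)
    then show ?thesis by (simp add: algebra_simps)
  qed
  also have "\<dots> \<le> exp 1 * (1 + sqrt n * \<epsilon>)\<^sup>2"
    using \<epsilon> by (intro mult_left_mono) (simp_all add: power2_sum power_mult_distrib)
  also have "\<dots> = (exp (1/2) * (1 + sqrt n * \<epsilon>))\<^sup>2"
    by (simp add: power_mult_distrib exp_double[symmetric])
  finally have "(exp (l / 2))\<^sup>2 \<le> (exp (1/2) * (1 + sqrt n * \<epsilon>))\<^sup>2"
    by (simp add: exp_double[symmetric])
  then have half: "exp (l / 2) \<le> exp (1/2) * (1 + sqrt n * \<epsilon>)"
    by (rule power2_le_imp_le) (use \<epsilon> in auto)
  have "exp (k / 2) \<le> exp (1/2 + l / 2)" using k_le l1 by simp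
  also have "\<dots> = exp (1/2) * exp (l / 2)" by (rule exp_add)
  also have "\<dots> \<le> exp (1/2) * (exp (1/2) * (1 + sqrt n * \<epsilon>))"
    using half by (intro mult_left_mono) auto
  also have "\<dots> = exp (1/2 + 1/2) * (1 + sqrt n * \<epsilon>)"
    unfolding exp_add by simp
  finally show "exp (k / 2) \<le> exp 1 * (1 + sqrt n * \<epsilon>)" by simp
qed

text \<open>
  The factor \<open>exp 1\<close> is the constant lost in the choice of the frequency.
\<close>

definition slack_const :: "real \<Rightarrow> real \<Rightarrow> real" where
  "slack_const \<delta> \<kappa> = 2 * \<kappa> * sqrt (8 * ln (10 / \<delta>)) * exp 1"

text \<open>
  With slack at most \<open>B F\<close> for \<open>F = 1 / \<surd>n + \<epsilon> \<le> 2\<close>, the bound \<open>3 \<epsilon> + D + D\<^sup>2\<close> is at most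
  \<open>(3 + B (1 + 2 B)) F\<close>. The other factors come from Jordan's inequality and from \<open>k \<ge> l / 8\<close>.
\<close>

definition radius_const :: "real \<Rightarrow> real \<Rightarrow> real \<Rightarrow> real" where
  "radius_const \<delta> \<epsilon>max \<kappa> = (let B = slack_const \<delta> \<kappa> in
     sqrt (4 * pi\<^sup>2 * (3 + B * (1 + 2 * B)) / (1 - 2 * \<epsilon>max)) * \<kappa>)"

text \<open>
  The hypothesis \<open>\<kappa> \<ge> \<surd>2\<close> is what turns \<open>exp (k / \<kappa>\<^sup>2)\<close> into at most \<open>exp (k / 2)\<close>.
\<close>

lemma slack_at_frequency:
  assumes "\<sigma> > 0" "\<kappa> \<ge> sqrt 2" "0 < \<delta>" "\<delta> < 1" "n \<ge> 1"
    and k: "exp (k / 2) \<le> exp 1 * (1 + sqrt n * \<epsilon>)" "k \<ge> 0"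
  shows "slack \<delta> \<kappa> \<sigma> n (sqrt k * inverse (\<kappa> * \<sigma>)) \<le> slack_const \<delta> \<kappa> * (1 / sqrt n + \<epsilon>)"
proof -
  have \<kappa>: "\<kappa> > 0" "\<kappa>\<^sup>2 \<ge> 2"
    using assms(2) real_sqrt_gt_zero[of 2] power_mono[OF assms(2), of 2] by (linarith, simp)
  have "\<sigma>\<^sup>2 * (sqrt k * inverse (\<kappa> * \<sigma>))\<^sup>2 = k / \<kappa>\<^sup>2"
    using assms \<kappa> by (simp add: power_mult_distrib field_simps)
  also have "k / \<kappa>\<^sup>2 \<le> k / 2"
    using \<kappa> k(2) by (intro divide_left_mono) auto
  finally have "exp (\<sigma>\<^sup>2 * (sqrt k * inverse (\<kappa> * \<sigma>))\<^sup>2) \<le> exp 1 * (1 + sqrt n * \<epsilon>)"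
    using k(1) by (meson exp_le_cancel_iff order_trans)
  then have "slack \<delta> \<kappa> \<sigma> n (sqrt k * inverse (\<kappa> * \<sigma>)) \<le>
      2 * \<kappa> * (exp 1 * (1 + sqrt n * \<epsilon>)) * sqrt (8 * ln (10 / \<delta>) / real n)"
    unfolding slack_def using assms \<kappa> by (intro mult_right_mono mult_left_mono) auto
  also have "\<dots> = slack_const \<delta> \<kappa> * ((1 + sqrt n * \<epsilon>) / sqrt n)"
    by (simp add: slack_const_def real_sqrt_divide)
  also have "(1 + sqrt n * \<epsilon>) / sqrt n = 1 / sqrt n + \<epsilon>"
    using assms by (simp add: field_simps)
  finally show ?thesis .
qed

text \<open>
  Every accepted candidate is close to \<open>\<theta>\<close>. Both lie in the pilot interval and \<open>M \<le> \<pi> \<kappa>\<close>, so at the chosen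
  frequency the angle between them is at most \<open>\<pi>\<close>; there \<open>1 - cos x\<close> is at least a multiple of \<open>x\<^sup>2\<close>, and
  a single accepted constraint bounds the distance.
\<close>

lemma distance_bound:
  fixes \<theta> \<mu> \<sigma> \<kappa> M \<epsilon> :: real
  assumes \<sigma>: "\<sigma> > 0" and \<delta>: "0 < \<delta>" "\<delta> < 1" and \<kappa>: "\<kappa> \<ge> sqrt 2" "\<kappa> \<ge> M / pi"
    and \<epsilon>: "0 \<le> \<epsilon>" "\<epsilon> \<le> \<epsilon>max" "\<epsilon>max < 1 / 2" and Q: "Q \<in> prob_dists"
    and n: "n \<ge> 1" "log_en n \<ge> 8"
    and acc: "char_accurate \<delta> \<kappa> \<sigma> n (two_groups \<theta> \<sigma> \<epsilon> Q) X"
    and pilot: "\<bar>\<tau> n X - \<theta>\<bar> \<le> M * \<sigma> / sqrt (log_en n)"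
    and \<mu>: "\<mu> \<in> conf_set \<delta> M \<kappa> \<sigma> \<tau> n X"
  shows "\<bar>\<mu> - \<theta>\<bar> \<le> length_bound (radius_const \<delta> \<epsilon>max \<kappa>) n \<sigma> \<epsilon>"
proof -
  define L where "L = log_en n"
  define l where "l = max 1 (ln (exp 1 * real n * \<epsilon>\<^sup>2))"
  define B where "B = slack_const \<delta> \<kappa>"
  define F where "F = 1 / sqrt n + \<epsilon>"
  define G where "G = 3 + B * (1 + 2 * B)"
  define c where "c = 1 - 2 * \<epsilon>max"
  have \<kappa>0: "\<kappa> > 0" using \<kappa>(1) real_sqrt_gt_zero[of 2] by linarith
  have l1: "l \<ge> 1" by (simp add: l_def)
  have c0: "c > 0" using \<epsilon> by (simp add: c_def)
  have B0: "B \<ge> 0" using \<kappa>0 \<delta> by (simp add: B_def slack_const_def)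
  have F0: "F \<ge> 0" "\<epsilon> \<le> F" using \<epsilon> by (auto simp: F_def)
  have "1 / sqrt n \<le> 1" using n by simp
  then have F2: "F \<le> 2" using \<epsilon> unfolding F_def by linarith
  obtain k :: nat where k: "1 \<le> k" "l / 8 \<le> k" "4 * real k \<le> L" "k \<le> nat \<lceil>L\<rceil>"
    "exp (k / 2) \<le> exp 1 * (1 + sqrt n * \<epsilon>)"
    using frequency_choice[OF \<epsilon>(1) _ n] \<epsilon> unfolding l_def L_def by auto
  define t where "t = sqrt k * inverse (\<kappa> * \<sigma>)"
  define x where "x = (\<mu> - \<theta>) * t"
  define D where "D = slack \<delta> \<kappa> \<sigma> n t"
  have t: "t \<in> freqs \<kappa> \<sigma> n" using k unfolding t_def freqs_def L_def by blast
  have t0: "t \<ge> 0" using \<kappa>0 \<sigma> by (simp add: t_def)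
  have D0: "D \<ge> 0" unfolding D_def slack_def using \<kappa>0 \<delta> by auto
  have DF: "D \<le> B * F"
    unfolding D_def B_def F_def t_def using slack_at_frequency[OF \<sigma> \<kappa>(1) \<delta> n(1) k(5)] by simp
  \<comment> \<open>The angle \<open>x\<close> is at most half a turn, so that its cosine determines its modulus.\<close>
  have "\<bar>\<mu> - \<theta>\<bar> \<le> 2 * (M * \<sigma> / sqrt L)"
    using pilot \<mu> unfolding conf_set_def pilot_CI_def L_def[symmetric] by auto
  also have "M * \<sigma> / sqrt L \<le> pi * \<kappa> * \<sigma> / sqrt L"
    using \<kappa>(2) \<sigma> n by (intro divide_right_mono mult_right_mono) (auto simp: field_simps L_def)
  finally have "\<bar>\<mu> - \<theta>\<bar> \<le> 2 * (pi * \<kappa> * \<sigma> / sqrt L)" by simp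
  then have "\<bar>\<mu> - \<theta>\<bar> * t \<le> 2 * (pi * \<kappa> * \<sigma> / sqrt L) * t"
    using t0 by (rule mult_right_mono)
  also have "\<bar>\<mu> - \<theta>\<bar> * t = \<bar>x\<bar>" using t0 by (simp add: x_def abs_mult)
  finally have "\<bar>x\<bar> \<le> 2 * (pi * \<kappa> * \<sigma> / sqrt L) * t" .
  also have "\<dots> = pi * (2 * sqrt k / sqrt L)"
    using \<sigma> \<kappa>0 by (simp add: t_def field_simps)
  also have "2 * sqrt k / sqrt L \<le> 1"
  proof -
    have "sqrt (4 * real k) \<le> sqrt L" using k(3) by (rule real_sqrt_le_mono)
    then show ?thesis using k(1,3) by (simp add: real_sqrt_mult divide_le_eq_1)
  qed
  finally have xpi: "\<bar>x\<bar> \<le> pi" by simp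
  have "2 * c * (x / pi)\<^sup>2 = c * (2 * (x / pi)\<^sup>2)" by simp
  also have "\<dots> \<le> (1 - 2 * \<epsilon>) * (1 - cos x)"
    using \<epsilon> jordan_cos[OF xpi] by (intro mult_mono) (auto simp: c_def)
  also have "\<dots> \<le> 3 * \<epsilon> + D + D\<^sup>2"
    unfolding x_def
    by (rule misfit_small[OF \<sigma> \<epsilon>(1) _ Q acc t]) (use \<epsilon> \<mu> t in \<open>auto simp: D_def conf_set_def\<close>)
  also have "\<dots> \<le> 3 * F + B * F + B * F * (B * 2)"
  proof -
    have "D * D \<le> (B * F) * (B * 2)"
      using DF D0 B0 F0 F2 by (intro mult_mono order_trans[OF DF] mult_left_mono) auto
    then show ?thesis using F0 DF by (simp add: power2_eq_square)
  qed
  also have "\<dots> = G * F" by (simp add: G_def algebra_simps)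
  finally have "x\<^sup>2 \<le> pi\<^sup>2 * G / (2 * c) * F"
    using c0 by (simp add: field_simps)
  moreover have "x\<^sup>2 = (\<mu> - \<theta>)\<^sup>2 * k / (\<kappa> * \<sigma>)\<^sup>2"
    by (simp add: x_def t_def power_mult_distrib power_inverse divide_inverse)
  ultimately have "(\<mu> - \<theta>)\<^sup>2 * k \<le> (\<kappa> * \<sigma>)\<^sup>2 * (pi\<^sup>2 * G / (2 * c) * F)"
    using \<sigma> \<kappa>0 by (simp add: pos_divide_le_eq mult.commute)
  moreover have "(\<mu> - \<theta>)\<^sup>2 * (l / 8) \<le> (\<mu> - \<theta>)\<^sup>2 * k"
    using k(2) by (intro mult_left_mono) auto
  ultimately have "(\<mu> - \<theta>)\<^sup>2 * (l / 8) \<le> (\<kappa> * \<sigma>)\<^sup>2 * (pi\<^sup>2 * G / (2 * c) * F)" by linarith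
  then have "(\<mu> - \<theta>)\<^sup>2 \<le> (\<kappa> * \<sigma>)\<^sup>2 * (4 * pi\<^sup>2 * G / c) * (F / l)"
    using l1 c0 by (simp add: field_simps)
  also have "\<dots> \<le> (\<kappa> * \<sigma>)\<^sup>2 * (4 * pi\<^sup>2 * G / c) * (1 / real n powr (1/4) + sqrt \<epsilon> / sqrt l)\<^sup>2"
  proof (intro mult_left_mono)
    have "F / l = 1 / sqrt n / l + \<epsilon> / l" by (simp add: F_def add_divide_distrib)
    also have "\<dots> \<le> 1 / sqrt n + \<epsilon> / l"
      using l1 n by (intro add_right_mono) (simp add: field_simps)
    also have "1 / sqrt n = (1 / real n powr (1/4))\<^sup>2"
    proof -
      have "sqrt n = real n powr (1/4 + 1/4)" using n by (simp add: powr_half_sqrt)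
      also have "\<dots> = (real n powr (1/4))\<^sup>2" unfolding powr_add by (simp add: power2_eq_square)
      finally show ?thesis by (simp add: power_divide)
    qed
    also have "\<epsilon> / l = (sqrt \<epsilon> / sqrt l)\<^sup>2"
      using \<epsilon> l1 by (simp add: power_divide)
    also have "(1 / real n powr (1/4))\<^sup>2 + (sqrt \<epsilon> / sqrt l)\<^sup>2 \<le> (1 / real n powr (1/4) + sqrt \<epsilon> / sqrt l)\<^sup>2"
      using \<epsilon> l1 by (simp add: power2_sum)
    finally show "F / l \<le> (1 / real n powr (1/4) + sqrt \<epsilon> / sqrt l)\<^sup>2" .
    show "0 \<le> (\<kappa> * \<sigma>)\<^sup>2 * (4 * pi\<^sup>2 * G / c)" using c0 B0 by (simp add: G_def)
  qed
  also have "\<dots> = (sqrt (4 * pi\<^sup>2 * G / c) * \<kappa> * \<sigma> * (1 / real n powr (1/4) + sqrt \<epsilon> / sqrt l))\<^sup>2"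
    using c0 B0 by (simp add: power_mult_distrib G_def)
  also have "\<dots> = (length_bound (radius_const \<delta> \<epsilon>max \<kappa>) n \<sigma> \<epsilon>)\<^sup>2"
    by (simp add: length_bound_def radius_const_def Let_def B_def G_def c_def l_def)
  finally have "\<bar>\<mu> - \<theta>\<bar>\<^sup>2 \<le> (length_bound (radius_const \<delta> \<epsilon>max \<kappa>) n \<sigma> \<epsilon>)\<^sup>2" by simp
  moreover have "0 \<le> length_bound (radius_const \<delta> \<epsilon>max \<kappa>) n \<sigma> \<epsilon>"
    using c0 B0 \<kappa>0 \<sigma> \<epsilon> by (simp add: length_bound_def radius_const_def Let_def flip: B_def c_def)
  ultimately show ?thesis by (rule power2_le_imp_le)
qed

section \<open>Probability of the good event\<close>

text \<open>
  At the \<open>k\<close>-th frequency the Hoeffding exponent is \<open>\<kappa>\<^sup>2 exp (k / \<kappa>\<^sup>2) ln (10 / \<delta>)\<close>, and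
  \<open>\<kappa>\<^sup>2 exp (k / \<kappa>\<^sup>2) \<ge> \<kappa>\<^sup>2 + k \<ge> k + 2\<close>. The failure probabilities therefore decay geometrically, and their
  sum is bounded although the number of frequencies grows with \<open>n\<close>.
\<close>

lemma prob_not_char_accurate:
  assumes \<sigma>: "\<sigma> > 0" and \<delta>: "0 < \<delta>" "\<delta> < 1" and \<kappa>: "\<kappa> \<ge> sqrt 2" and n: "n \<ge> 1"
    and P: "real_distribution P"
  shows "{X \<in> space (\<Pi>\<^sub>M j\<in>{1..n}. P). \<not> char_accurate \<delta> \<kappa> \<sigma> n P X} \<in> sets (\<Pi>\<^sub>M j\<in>{1..n}. P)" (is ?meas)
    and "measure (\<Pi>\<^sub>M j\<in>{1..n}. P)
      {X \<in> space (\<Pi>\<^sub>M j\<in>{1..n}. P). \<not> char_accurate \<delta> \<kappa> \<sigma> n P X} \<le> \<delta> / 2" (is ?bound)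
proof -
  interpret P: real_distribution P by fact
  let ?M = "\<Pi>\<^sub>M j\<in>{1..n}. P"
  interpret prob_space ?M by (intro prob_space_PiM P.prob_space_axioms)
  have sets_M: "sets ?M = sets (\<Pi>\<^sub>M j\<in>{1..n}. borel)" by (intro sets_PiM_cong) auto
  have [measurable]: "(\<lambda>X. emp_char n X t) \<in> borel_measurable ?M" for t
    using measurable_emp_char[of n t] measurable_cong_sets[OF sets_M refl] by blast
  define K where "K = {1..nat \<lceil>log_en n\<rceil>}"
  define t where "t k = sqrt (real k) * inverse (\<kappa> * \<sigma>)" for k
  define A where "A k = slack \<delta> \<kappa> \<sigma> n (t k) / (2 * exp (\<sigma>\<^sup>2 * (t k)\<^sup>2 / 2))" for k
  define E where "E k = {X \<in> space ?M. A k < cmod (emp_char n X (t k) - char P (t k))}" for k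
  have freqs: "freqs \<kappa> \<sigma> n = t ` K" by (auto simp: freqs_def K_def t_def)
  have eq: "{X \<in> space ?M. \<not> char_accurate \<delta> \<kappa> \<sigma> n P X} = (\<Union>k\<in>K. E k)"
    unfolding char_accurate_def freqs E_def A_def by (auto simp: field_simps not_le)
  have E[measurable]: "E k \<in> sets ?M" for k unfolding E_def by measurable
  show ?meas unfolding eq by (rule sets.finite_UN[OF _ E]) (simp add: K_def)
  have \<kappa>2: "\<kappa>\<^sup>2 \<ge> 2" using power_mono[OF \<kappa>, of 2] by simp
  have \<kappa>0: "\<kappa> > 0" using \<kappa> real_sqrt_gt_zero[of 2] by linarith
  have small: "prob (E k) \<le> \<delta> / 2 * (1 / 2) ^ k" for k
  proof -
    define u where "u = real k / \<kappa>\<^sup>2"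
    have tu: "\<sigma>\<^sup>2 * (t k)\<^sup>2 = u"
      using \<sigma> \<kappa>0 by (simp add: t_def u_def power_mult_distrib field_simps)
    have "exp u = exp (u / 2) * exp (u / 2)" by (simp flip: exp_add)
    then have Ak: "A k = \<kappa> * exp (u / 2) * sqrt (8 * ln (10 / \<delta>) / n)"
      unfolding A_def slack_def tu by simp
    have ln0: "ln (10 / \<delta>) > 0" using \<delta> by simp
    have "n * (A k)\<^sup>2 / 8 = \<kappa>\<^sup>2 * (exp (u / 2))\<^sup>2 * ln (10 / \<delta>)"
      unfolding Ak using n ln0 by (simp add: power_mult_distrib)
    also have "(exp (u / 2))\<^sup>2 = exp u" by (simp flip: exp_double)
    finally have nA: "n * (A k)\<^sup>2 / 8 = \<kappa>\<^sup>2 * exp u * ln (10 / \<delta>)" .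
    have "real (k + 2) \<le> \<kappa>\<^sup>2 * (1 + u)"
      using \<kappa>2 \<kappa>0 by (simp add: u_def distrib_left)
    also have "\<dots> \<le> \<kappa>\<^sup>2 * exp u" by (intro mult_left_mono exp_ge_add_one_self) auto
    finally have "real (k + 2) * ln (10 / \<delta>) \<le> n * (A k)\<^sup>2 / 8"
      unfolding nA using ln0 by (intro mult_right_mono) auto
    then have "exp (- (n * (A k)\<^sup>2 / 8)) \<le> exp (real (k + 2) * (- ln (10 / \<delta>)))" by simp
    also have "\<dots> = (\<delta> / 10) ^ (k + 2)"
      unfolding exp_of_nat_mult using \<delta> by (simp add: exp_minus)
    also have "\<dots> = (\<delta> / 10)\<^sup>2 * (\<delta> / 10) ^ k" by (simp only: power_add mult.commute)
    also have "\<dots> \<le> \<delta> / 8 * (1 / 2) ^ k"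
    proof (intro mult_mono power_mono)
      have "\<delta> * \<delta> \<le> \<delta> * 1" using \<delta> by (intro mult_left_mono) auto
      then show "(\<delta> / 10)\<^sup>2 \<le> \<delta> / 8" using \<delta> by (simp add: power2_eq_square)
    qed (use \<delta> in auto)
    finally have e: "4 * exp (- (n * (A k)\<^sup>2 / 8)) \<le> \<delta> / 2 * (1 / 2) ^ k" by simp
    have "A k \<ge> 0" unfolding Ak using \<kappa>0 ln0 by simp
    from emp_char_deviation[OF P n this, of "t k"] e
    show ?thesis unfolding E_def by linarith
  qed
  have "prob (\<Union>k\<in>K. E k) \<le> (\<Sum>k\<in>K. prob (E k))"
    by (rule finite_measure_subadditive_finite) (use E in \<open>auto simp: K_def simp del: One_nat_def\<close>)
  also have "\<dots> \<le> (\<Sum>k\<in>K. \<delta> / 2 * (1 / 2) ^ k)" by (intro sum_mono small)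
  also have "\<dots> = \<delta> / 2 * (\<Sum>k\<in>K. (1 / 2) ^ k)" by (simp add: sum_distrib_left)
  also have "(\<Sum>k\<in>K. (1 / 2 :: real) ^ k) \<le> 1"
  proof -
    have "(\<Sum>k=1..m. (1 / 2 :: real) ^ k) = 1 - (1 / 2) ^ m" for m
      by (induction m) simp_all
    then show ?thesis by (simp add: K_def del: One_nat_def)
  qed
  finally show ?bound unfolding eq using \<delta> by simp
qed

lemma pilot_bound:
  assumes pilot: "pilot_estimator \<delta> \<epsilon>max M N0 \<tau>" and n: "n \<ge> 1" "n \<ge> N0"
    and \<sigma>: "\<sigma> > 0" and \<epsilon>: "0 \<le> \<epsilon>" "\<epsilon> \<le> \<epsilon>max" "0 < \<epsilon>max" "\<epsilon>max \<le> 1" and Q: "Q \<in> prob_dists"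
  shows "measure (sample_law n \<theta> \<sigma> \<epsilon> Q)
      {X \<in> space (sample_law n \<theta> \<sigma> \<epsilon> Q). \<bar>\<tau> n X - \<theta>\<bar> \<le> M * \<sigma> / sqrt (log_en n)} \<ge> 1 - \<delta> / 2"
proof -
  let ?f = "\<lambda>(\<theta>, \<sigma>, Q). measure (sample_law n \<theta> \<sigma> \<epsilon>max Q)
      {X \<in> space (sample_law n \<theta> \<sigma> \<epsilon>max Q). \<bar>\<tau> n X - \<theta>\<bar> \<le> M * \<sigma> / sqrt (log_en n)}"
  define Q' where "Q' = mix_point (\<epsilon> / \<epsilon>max) \<theta> Q"
  have "1 - \<delta> / 2 \<le> (INF p\<in>UNIV \<times> {0<..} \<times> prob_dists. ?f p)"
    using pilot n unfolding pilot_estimator_def by blast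
  also have "\<dots> \<le> ?f (\<theta>, \<sigma>, Q')"
    using \<sigma> mix_point_prob_dists[OF Q]
    by (intro cINF_lower bdd_belowI2[where m = 0]) (auto simp: Q'_def)
  finally have "1 - \<delta> / 2 \<le> ?f (\<theta>, \<sigma>, Q')" .
  moreover have "sample_law n \<theta> \<sigma> \<epsilon>max Q' = sample_law n \<theta> \<sigma> \<epsilon> Q"
    unfolding sample_law_def Q'_def using two_groups_inflate[OF \<sigma> \<epsilon> Q] by simp
  ultimately show ?thesis by simp
qed

theorem theorem1:
  fixes \<delta> \<epsilon>max M \<kappa> :: real and N0 :: nat
  assumes "0 < \<delta>" "\<delta> < 1"
    and "0 < \<epsilon>max" "\<epsilon>max < 1 / 2"
    and "\<kappa> \<ge> max (sqrt 2) (M / pi)"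
  shows "\<exists>C>0. \<exists>N. \<forall>\<sigma>>0. \<forall>\<tau>. pilot_estimator \<delta> \<epsilon>max M N0 \<tau> \<longrightarrow>
    (\<forall>n\<ge>N.
      (INF \<theta>. INF (\<epsilon>, Q) \<in> {0..\<epsilon>max} \<times> prob_dists.
         measure (sample_law n \<theta> \<sigma> \<epsilon> Q)
           {X \<in> space (sample_law n \<theta> \<sigma> \<epsilon> Q).
              \<theta> \<in> conf_set \<delta> M \<kappa> \<sigma> \<tau> n X \<and>
              set_length (conf_set \<delta> M \<kappa> \<sigma> \<tau> n X) \<le> length_bound C n \<sigma> \<epsilon>})
      \<ge> 1 - \<delta>)"
proof -
  note \<delta> = assms(1,2)
  have \<kappa>: "\<kappa> \<ge> sqrt 2" "\<kappa> \<ge> M / pi" using assms(5) by auto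
  have \<kappa>0: "\<kappa> > 0" using \<kappa>(1) real_sqrt_gt_zero[of 2] by linarith
  define R where "R = radius_const \<delta> \<epsilon>max \<kappa>"
  have "slack_const \<delta> \<kappa> \<ge> 0" using \<kappa>0 \<delta> by (simp add: slack_const_def)
  then have "R > 0"
    unfolding R_def radius_const_def Let_def using \<kappa>0 assms(4)
    by (intro mult_pos_pos real_sqrt_gt_zero divide_pos_pos add_pos_nonneg) auto
  have main: "measure (sample_law n \<theta> \<sigma> \<epsilon> Q)
      {X \<in> space (sample_law n \<theta> \<sigma> \<epsilon> Q). \<theta> \<in> conf_set \<delta> M \<kappa> \<sigma> \<tau> n X \<and>
         set_length (conf_set \<delta> M \<kappa> \<sigma> \<tau> n X) \<le> length_bound (2 * R) n \<sigma> \<epsilon>} \<ge> 1 - \<delta>"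
    if \<sigma>: "\<sigma> > 0" and pilot: "pilot_estimator \<delta> \<epsilon>max M N0 \<tau>"
      and N: "n \<ge> max N0 (nat \<lceil>exp (7::real)\<rceil>)"
      and \<epsilon>: "0 \<le> \<epsilon>" "\<epsilon> \<le> \<epsilon>max" and Q: "Q \<in> prob_dists" for \<sigma> \<tau> n \<theta> \<epsilon> Q
  proof -
    have "real n \<ge> exp 7" using N by linarith
    then have n: "n \<ge> 1" "log_en n \<ge> 8"
      using ln_mono[of "exp 7" "real n"] exp_gt_zero[of "7::real"]
      by (auto simp: log_en_def ln_mult Suc_le_eq simp del: exp_gt_zero intro!: Nat.gr0I)
    define P where "P = two_groups \<theta> \<sigma> \<epsilon> Q"
    have "prob_space P" unfolding P_def by (rule prob_space_two_groups) (use \<sigma> \<epsilon> Q assms in auto)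
    then have P: "real_distribution P"
      by (simp add: real_distribution_def real_distribution_axioms_def P_def)
    have law: "sample_law n \<theta> \<sigma> \<epsilon> Q = (\<Pi>\<^sub>M j\<in>{1..n}. P)" by (simp add: sample_law_def P_def)
    let ?M = "\<Pi>\<^sub>M j\<in>{1..n}. P"
    interpret prob_space ?M by (intro prob_space_PiM \<open>prob_space P\<close>)
    have sets_M: "sets ?M = sets (\<Pi>\<^sub>M j\<in>{1..n}. borel)" by (intro sets_PiM_cong) (auto simp: P_def)
    have \<tau>: "\<tau> n \<in> borel_measurable (\<Pi>\<^sub>M j\<in>{1..n}. borel)"
      using pilot by (simp add: pilot_estimator_def)
    then have [measurable]: "\<tau> n \<in> borel_measurable ?M"
      using measurable_cong_sets[OF sets_M refl] by blast
    define A where "A = {X \<in> space ?M. \<bar>\<tau> n X - \<theta>\<bar> \<le> M * \<sigma> / sqrt (log_en n)}"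
    define B where "B = {X \<in> space ?M. \<not> char_accurate \<delta> \<kappa> \<sigma> n P X}"
    define G where "G = {X \<in> space ?M. \<theta> \<in> conf_set \<delta> M \<kappa> \<sigma> \<tau> n X \<and>
       set_length (conf_set \<delta> M \<kappa> \<sigma> \<tau> n X) \<le> length_bound (2 * R) n \<sigma> \<epsilon>}"
    have A: "A \<in> sets ?M" unfolding A_def by measurable
    have B: "B \<in> sets ?M" "prob B \<le> \<delta> / 2"
      unfolding B_def by (rule prob_not_char_accurate[OF \<sigma> \<delta> \<kappa>(1) n(1) P])+
    have G: "G \<in> sets ?M"
      unfolding G_def sets_M sets_eq_imp_space_eq[OF sets_M] by (rule conf_set_event_measurable) (rule \<tau>)
    have "1 - \<delta> / 2 \<le> prob A"
      unfolding A_def law[symmetric]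
      by (rule pilot_bound[OF pilot n(1) _ \<sigma> \<epsilon> _ _ Q]) (use N assms in auto)
    also have "prob A \<le> prob ((A - B) \<union> B)"
      using A B by (intro finite_measure_mono) auto
    also have "\<dots> \<le> prob (A - B) + prob B" using A B by (intro measure_Un_le) auto
    \<comment> \<open>Outside \<open>B\<close> the argument is deterministic.\<close>
    also have "prob (A - B) \<le> prob G"
    proof (rule finite_measure_mono[OF _ G], rule subsetI)
      fix X assume X: "X \<in> A - B"
      let ?K = "conf_set \<delta> M \<kappa> \<sigma> \<tau> n X"
      have acc: "char_accurate \<delta> \<kappa> \<sigma> n (two_groups \<theta> \<sigma> \<epsilon> Q) X"
        and near: "\<bar>\<tau> n X - \<theta>\<bar> \<le> M * \<sigma> / sqrt (log_en n)"
        using X by (auto simp: A_def B_def P_def)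
      have \<theta>K: "\<theta> \<in> ?K"
        using near coverage[OF \<sigma> \<epsilon>(1) _ Q acc] \<epsilon> assms(4) by (auto simp: conf_set_def pilot_CI_def)
      have "?K \<subseteq> pilot_CI M \<sigma> \<tau> n X" by (auto simp: conf_set_def)
      then have "bounded ?K" by (rule bounded_subset[rotated]) (simp add: pilot_CI_def)
      moreover have "\<nu> - \<mu> \<le> length_bound (2 * R) n \<sigma> \<epsilon>" if "\<mu> \<in> ?K" "\<nu> \<in> ?K" for \<mu> \<nu>
      proof -
        have "\<bar>\<eta> - \<theta>\<bar> \<le> length_bound R n \<sigma> \<epsilon>" if "\<eta> \<in> ?K" for \<eta>
          unfolding R_def
          by (rule distance_bound[OF \<sigma> \<delta> \<kappa> \<epsilon> assms(4) Q n acc near that])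
        from this[OF \<open>\<mu> \<in> ?K\<close>] this[OF \<open>\<nu> \<in> ?K\<close>]
        have "\<nu> - \<mu> \<le> 2 * length_bound R n \<sigma> \<epsilon>" by linarith
        then show ?thesis by (simp add: length_bound_def)
      qed
      ultimately have "set_length ?K \<le> length_bound (2 * R) n \<sigma> \<epsilon>"
        using \<theta>K by (subst set_length_le_iff) auto
      with \<theta>K X show "X \<in> G" by (simp add: G_def A_def)
    qed
    finally show ?thesis using B(2) unfolding G_def law by linarith
  qed
  have ne: "prob_dists \<noteq> {}"
  proof -
    have "return borel 0 \<in> prob_dists" by (auto simp: prob_dists_def intro: prob_space_return)
    then show ?thesis by blast
  qed
  show ?thesis
  proof (intro exI[of _ "2 * R"] exI[of _ "max N0 (nat \<lceil>exp (7::real)\<rceil>)"] conjI allI impI)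
    show "2 * R > 0" using \<open>R > 0\<close> by simp
  qed (intro cINF_greatest; use ne assms(3) main in auto)
qed

end
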